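(* Let $p$ be a prime, let $M,N$ be integers, and let $\phi\in\mathcal{D}_N^M$ be an orthogonal scaling function with $\widehat\phi(0)\ne 0$. Then $\operatorname{supp}\widehat\phi\subset B_0(0)$.
   Context: $\mathbb{Q}_p$ is the field of $p$-adic numbers with norm $|\cdot|_p$ (so $|p|_p=p^{-1}$) and Haar measure $dx$ normalized so that the unit disc $\{|x|_p\le 1\}$ has measure $1$; $B_\gamma(a)=\{x\in\mathbb{Q}_p:|x-a|_p\le p^\gamma\}$ for $\gamma\in\mathbb{Z}$. The set of shifts is $I_p=\{p^{-\gamma}(a_0+a_1p+\cdots+a_{\gamma-1}p^{\gamma-1}):\gamma\in\mathbb{N},\ a_j\in\{0,1,\dots,p-1\}\}$. The Fourier transform is $\widehat\varphi(\xi)=\int_{\mathbb{Q}_p}\chi_p(\xi x)\varphi(x)\,dx$, where $\chi_p(x)=e^{2\pi i\{x\}_p}$ and $\{x\}_p$ is the fractional part of $x$. $\mathcal{D}$ is the space of complex-valued locally constant compactly supported functions on $\mathbb{Q}_p$. $\mathcal{D}_N^M$ is the set of $\phi\in\mathcal{D}$ that are $p^M$-periodic ($\phi(x-p^M)=\phi(x)$ for all $x$) and supported on $B_N(0)$; equivalently $\operatorname{supp}\phi\subset B_N(0)$ and $\operatorname{supp}\widehat\phi\subset B_M(0)$. A multiresolution analysis (MRA) in $L^2(\mathbb{Q}_p)$ is a collection of closed subspaces $V_j\subset L^2(\mathbb{Q}_p)$, $j\in\mathbb{Z}$, such that: (a) $V_j\subset V_{j+1}$ for all $j$; (b) $\bigcup_{j}V_j$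 is dense in $L^2(\mathbb{Q}_p)$; (c) $\bigcap_j V_j=\{0\}$; (d) $f(\cdot)\in V_j\Longleftrightarrow f(p^{-1}\cdot)\in V_{j+1}$ for all $j$; (e) there is a function $\phi\in V_0$ with $V_0=\overline{\operatorname{span}\{\phi(\cdot-a):a\in I_p\}}$. The function $\phi$ in (e) is called a scaling function of the MRA. A scaling function $\phi$ (of some MRA) is called orthogonal if $\{\phi(\cdot-a):a\in I_p\}$ is an orthonormal basis of $V_0$. *)

theory Defs
  imports "HOL-Analysis.Analysis" "HOL-Computational_Algebra.Primes"
begin

section \<open>The p-adic absolute value on the rationals\<close>

definition padic_abs :: "nat \<Rightarrow> rat \<Rightarrow> real" where
  "padic_abs p q = (if q = 0 then 0 else
     (case quotient_of q of (a, b) \<Rightarrow>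
        real p powi (int (multiplicity (int p) b) - int (multiplicity (int p) a))))"

lemma padic_abs_frac:
  assumes "prime p" "a \<noteq> 0" "b \<noteq> 0"
  shows "padic_abs p (of_int a / of_int b) =
           real p powi (int (multiplicity (int p) b) - int (multiplicity (int p) a))"
proof -
  obtain c d where cd: "quotient_of (of_int a / of_int b) = (c, d)"
    by (cases "quotient_of (of_int a / of_int b)") auto
  have d: "d > 0" using quotient_of_denom_pos[OF cd] .
  have eq: "(of_int a / of_int b :: rat) = of_int c / of_int d"
    using quotient_of_div[OF cd] .
  with assms d have c: "c \<noteq> 0" by auto
  from eq assms d have "(of_int (a * d) :: rat) = of_int (c * b)"
    by (simp add: field_simps)
  hence e: "a * d = c * b" by linarith
  have pe: "prime_elem (int p)" using assms(1) by simp
  have "multiplicity (int p) (a * d) = multiplicity (int p) (c * b)" using e by simp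
  hence "multiplicity (int p) a + multiplicity (int p) d
       = multiplicity (int p) c + multiplicity (int p) b"
    using pe assms c d by (simp add: prime_elem_multiplicity_mult_distrib)
  hence "int (multiplicity (int p) d) - int (multiplicity (int p) c)
       = int (multiplicity (int p) b) - int (multiplicity (int p) a)" by linarith
  then show ?thesis using cd assms by (simp add: padic_abs_def)
qed

lemma rat_frac_cases:
  fixes q :: rat
  assumes "q \<noteq> 0"
  obtains a b where "q = of_int a / of_int b" "a \<noteq> 0" "b \<noteq> 0"
proof -
  obtain a b where ab: "quotient_of q = (a, b)" by (cases "quotient_of q") auto
  from quotient_of_div[OF ab] quotient_of_denom_pos[OF ab] assms that show ?thesis by force
qed

lemma padic_abs_0 [simp]: "padic_abs p 0 = 0"
  by (simp add: padic_abs_def)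

lemma padic_abs_1 [simp]: "padic_abs p 1 = 1"
  by (simp add: padic_abs_def)

lemma padic_abs_nonneg [simp]: "padic_abs p q \<ge> 0"
  by (simp add: padic_abs_def split: prod.split)

lemma padic_abs_minus [simp]: "padic_abs p (- q) = padic_abs p q"
proof (cases "q = 0")
  case False
  obtain a b where ab: "quotient_of q = (a, b)" by (cases "quotient_of q") auto
  hence "quotient_of (- q) = (- a, b)" by (simp add: rat_uminus_code)
  moreover have "multiplicity (int p) (- a) = multiplicity (int p) a"
    by (simp add: multiplicity_def)
  ultimately show ?thesis using ab False by (simp add: padic_abs_def)
qed simp

context
  fixes p :: nat
  assumes prime_p: "prime p"
begin

lemma padic_abs_eq_0_iff: "padic_abs p q = 0 \<longleftrightarrow> q = 0"
  using prime_p by (auto simp: padic_abs_def split: prod.splits)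

lemma padic_abs_pos_iff: "padic_abs p q > 0 \<longleftrightarrow> q \<noteq> 0"
  using padic_abs_eq_0_iff[of q] padic_abs_nonneg[of p q] by linarith

lemma padic_abs_mult: "padic_abs p (x * y) = padic_abs p x * padic_abs p y"
proof (cases "x = 0 \<or> y = 0")
  case False
  then obtain a b c d where
    x: "x = of_int a / of_int b" "a \<noteq> 0" "b \<noteq> 0" and
    y: "y = of_int c / of_int d" "c \<noteq> 0" "d \<noteq> 0"
    by (metis rat_frac_cases)
  have xy: "x * y = of_int (a * c) / of_int (b * d)" using x y by simp
  have pe: "prime_elem (int p)" using prime_p by simp
  have p0: "real p \<noteq> 0" using prime_p by auto
  have "padic_abs p (x * y) = real p powi (int (multiplicity (int p) (b * d))
          - int (multiplicity (int p) (a * c)))"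
    unfolding xy using x y by (intro padic_abs_frac prime_p) auto
  also have "\<dots> = real p powi ((int (multiplicity (int p) b) - int (multiplicity (int p) a))
       + (int (multiplicity (int p) d) - int (multiplicity (int p) c)))"
    using pe x y by (simp add: prime_elem_multiplicity_mult_distrib algebra_simps)
  also have "\<dots> = padic_abs p x * padic_abs p y"
    using x y p0 by (simp add: padic_abs_frac prime_p power_int_add)
  finally show ?thesis .
qed auto

lemma padic_abs_inverse: "padic_abs p (inverse x) = inverse (padic_abs p x)"
proof (cases "x = 0")
  case False
  have "padic_abs p (x * inverse x) = 1" using False by simp
  hence "padic_abs p x * padic_abs p (inverse x) = 1" by (simp only: padic_abs_mult)
  then show ?thesis by (metis inverse_unique)
qed simp

lemma padic_abs_add_le_max: "padic_abs p (x + y) \<le> max (padic_abs p x) (padic_abs p y)"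
proof (cases "x = 0 \<or> y = 0 \<or> x + y = 0")
  case True
  then show ?thesis by (auto simp: le_max_iff_disj)
next
  case False
  then obtain a b c d where
    x: "x = of_int a / of_int b" "a \<noteq> 0" "b \<noteq> 0" and
    y: "y = of_int c / of_int d" "c \<noteq> 0" "d \<noteq> 0"
    by (metis rat_frac_cases)
  let ?v = "multiplicity (int p)"
  have pe: "prime_elem (int p)" using prime_p by simp
  have p1: "real p \<ge> 1" using prime_p prime_ge_1_nat by simp
  have nu: "\<not> is_unit (int p)" using prime_gt_1_nat[OF prime_p] by simp
  have xy: "x + y = of_int (a * d + c * b) / of_int (b * d)"
    using x y by (simp add: field_simps)
  have nz: "a * d + c * b \<noteq> 0" using xy False by (metis of_int_0 div_0)
  let ?m = "min (?v (a * d)) (?v (c * b))"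
  have "int p ^ ?m dvd a * d + c * b"
    by (intro dvd_add multiplicity_dvd') auto
  hence ge: "?v (a * d + c * b) \<ge> ?m"
    using nz nu by (intro multiplicity_geI) auto
  have "padic_abs p (x + y) = real p powi (int (?v (b * d)) - int (?v (a * d + c * b)))"
    unfolding xy using x y nz by (intro padic_abs_frac prime_p) auto
  also have "\<dots> \<le> real p powi (max (int (?v b) - int (?v a)) (int (?v d) - int (?v c)))"
  proof (rule power_int_increasing)
    show "int (?v (b * d)) - int (?v (a * d + c * b))
            \<le> max (int (?v b) - int (?v a)) (int (?v d) - int (?v c))"
      using ge pe x y by (simp add: prime_elem_multiplicity_mult_distrib)
  qed (use p1 in auto)
  also have "\<dots> \<le> max (padic_abs p x) (padic_abs p y)"
    using x y by (simp add: padic_abs_frac prime_p max_def)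
  finally show ?thesis .
qed

lemma padic_abs_add_le: "padic_abs p (x + y) \<le> padic_abs p x + padic_abs p y"
  using padic_abs_add_le_max[of x y] padic_abs_nonneg[of p x] padic_abs_nonneg[of p y] by linarith

end

lemma padic_abs_diff_commute: "padic_abs p (x - y) = padic_abs p (y - x)"
  by (metis minus_diff_eq padic_abs_minus)


section \<open>The field of p-adic numbers\<close>

text \<open>
  As with the reals in \<^theory>\<open>HOL.Real\<close>, the field is the quotient of the Cauchy sequences
  of rationals by the null sequences, here with respect to the p-adic absolute value.
\<close>

definition padic_null :: "nat \<Rightarrow> (nat \<Rightarrow> rat) \<Rightarrow> bool" where
  "padic_null p X \<longleftrightarrow> (\<lambda>n. padic_abs p (X n)) \<longlonglongrightarrow> 0"

definition padic_cauchy :: "nat \<Rightarrow> (nat \<Rightarrow> rat) \<Rightarrow> bool" where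
  "padic_cauchy p X \<longleftrightarrow> (\<forall>e>0. \<exists>k. \<forall>m\<ge>k. \<forall>n\<ge>k. padic_abs p (X m - X n) < e)"

definition padic_rel :: "nat \<Rightarrow> (nat \<Rightarrow> rat) \<Rightarrow> (nat \<Rightarrow> rat) \<Rightarrow> bool" where
  "padic_rel p X Y \<longleftrightarrow> padic_cauchy p X \<and> padic_cauchy p Y \<and> padic_null p (\<lambda>n. X n - Y n)"

lemma padic_cauchy_const [simp]: "padic_cauchy p (\<lambda>n. c)"
  by (simp add: padic_cauchy_def)

lemma padic_null_zero [simp]: "padic_null p (\<lambda>n. 0)"
  by (simp add: padic_null_def)

lemma padic_cauchy_minus: "padic_cauchy p X \<Longrightarrow> padic_cauchy p (\<lambda>n. - X n)"
  unfolding padic_cauchy_def by (simp add: padic_abs_diff_commute)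

lemma padic_null_minus: "padic_null p X \<Longrightarrow> padic_null p (\<lambda>n. - X n)"
  by (simp add: padic_null_def)

context
  fixes p :: nat
  assumes prime_p: "prime p"
begin

lemmas padic_abs_facts =
  padic_abs_mult[OF prime_p] padic_abs_add_le[OF prime_p] padic_abs_eq_0_iff[OF prime_p]

lemma padic_null_le:
  assumes "\<And>n. padic_abs p (X n) \<le> f n" "f \<longlonglongrightarrow> 0"
  shows "padic_null p X"
  unfolding padic_null_def using assms
  by (intro tendsto_sandwich[OF _ _ tendsto_const assms(2)]) auto

lemma padic_null_add:
  assumes "padic_null p X" "padic_null p Y"
  shows "padic_null p (\<lambda>n. X n + Y n)"
proof (rule padic_null_le)
  show "(\<lambda>n. padic_abs p (X n) + padic_abs p (Y n)) \<longlonglongrightarrow> 0"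
    using tendsto_add[OF assms[unfolded padic_null_def]] by simp
qed (rule padic_abs_facts)

lemma padic_cauchy_add:
  assumes X: "padic_cauchy p X" and Y: "padic_cauchy p Y"
  shows "padic_cauchy p (\<lambda>n. X n + Y n)"
  unfolding padic_cauchy_def
proof (intro allI impI)
  fix e :: real assume "e > 0"
  hence e2: "e / 2 > 0" by simp
  obtain i where i: "\<And>m n. m \<ge> i \<Longrightarrow> n \<ge> i \<Longrightarrow> padic_abs p (X m - X n) < e / 2"
    using X e2 unfolding padic_cauchy_def by blast
  obtain j where j: "\<And>m n. m \<ge> j \<Longrightarrow> n \<ge> j \<Longrightarrow> padic_abs p (Y m - Y n) < e / 2"
    using Y e2 unfolding padic_cauchy_def by blast
  have "padic_abs p ((X m + Y m) - (X n + Y n)) < e" if "m \<ge> max i j" "n \<ge> max i j" for m n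
  proof -
    have "padic_abs p ((X m - X n) + (Y m - Y n)) \<le> padic_abs p (X m - X n) + padic_abs p (Y m - Y n)"
      by (rule padic_abs_facts)
    also have "\<dots> < e" using i[of m n] j[of m n] that by simp
    finally show ?thesis by (simp add: algebra_simps)
  qed
  then show "\<exists>k. \<forall>m\<ge>k. \<forall>n\<ge>k. padic_abs p ((X m + Y m) - (X n + Y n)) < e" by blast
qed

lemma padic_abs_diff_abs: "\<bar>padic_abs p x - padic_abs p y\<bar> \<le> padic_abs p (x - y)"
  using padic_abs_facts(2)[of "x - y" y] padic_abs_facts(2)[of "y - x" x]
  by (simp add: padic_abs_diff_commute[of p y x] abs_le_iff)

lemma padic_cauchy_abs_convergent:
  assumes "padic_cauchy p X"
  shows "convergent (\<lambda>n. padic_abs p (X n))"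
proof (rule Cauchy_convergent, rule metric_CauchyI)
  fix e :: real assume "e > 0"
  then obtain k where k: "\<forall>m\<ge>k. \<forall>n\<ge>k. padic_abs p (X m - X n) < e"
    using assms unfolding padic_cauchy_def by blast
  have "dist (padic_abs p (X m)) (padic_abs p (X n)) < e" if "m \<ge> k" "n \<ge> k" for m n
    using k that padic_abs_diff_abs[of "X m" "X n"] by (fastforce simp: dist_real_def)
  then show "\<exists>k. \<forall>m\<ge>k. \<forall>n\<ge>k. dist (padic_abs p (X m)) (padic_abs p (X n)) < e" by blast
qed

lemma padic_cauchy_bounded:
  assumes "padic_cauchy p X"
  obtains B where "B > 0" "\<And>n. padic_abs p (X n) \<le> B"
proof -
  have "Bseq (\<lambda>n. padic_abs p (X n))"
    using padic_cauchy_abs_convergent[OF assms] by (rule convergent_imp_Bseq)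
  then show ?thesis using that unfolding Bseq_def by auto
qed

lemma padic_null_mult:
  assumes "padic_cauchy p X" "padic_null p Y"
  shows "padic_null p (\<lambda>n. X n * Y n)"
proof -
  obtain B where B: "B > 0" "\<And>n. padic_abs p (X n) \<le> B"
    using padic_cauchy_bounded[OF assms(1)] by blast
  show ?thesis
  proof (rule padic_null_le)
    show "padic_abs p (X n * Y n) \<le> B * padic_abs p (Y n)" for n
      using B by (simp add: padic_abs_facts mult_right_mono)
    show "(\<lambda>n. B * padic_abs p (Y n)) \<longlonglongrightarrow> 0"
      using tendsto_mult_left[OF assms(2)[unfolded padic_null_def], of B] by simp
  qed
qed

lemma padic_cauchy_mult:
  assumes X: "padic_cauchy p X" and Y: "padic_cauchy p Y"
  shows "padic_cauchy p (\<lambda>n. X n * Y n)"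
  unfolding padic_cauchy_def
proof (intro allI impI)
  fix e :: real assume e: "e > 0"
  obtain A where A: "A > 0" "\<And>n. padic_abs p (X n) \<le> A" using padic_cauchy_bounded[OF X] by blast
  obtain B where B: "B > 0" "\<And>n. padic_abs p (Y n) \<le> B" using padic_cauchy_bounded[OF Y] by blast
  have "e / (2 * A) > 0" "e / (2 * B) > 0" using e A B by auto
  then obtain i j where
    i: "\<And>m n. m \<ge> i \<Longrightarrow> n \<ge> i \<Longrightarrow> padic_abs p (X m - X n) < e / (2 * B)" and
    j: "\<And>m n. m \<ge> j \<Longrightarrow> n \<ge> j \<Longrightarrow> padic_abs p (Y m - Y n) < e / (2 * A)"
    using X Y unfolding padic_cauchy_def by meson
  have "padic_abs p (X m * Y m - X n * Y n) < e" if "m \<ge> max i j" "n \<ge> max i j" for m n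
  proof -
    have "padic_abs p (X m * Y m - X n * Y n)
        = padic_abs p (X m * (Y m - Y n) + (X m - X n) * Y n)" by (simp add: algebra_simps)
    also have "\<dots> \<le> padic_abs p (X m) * padic_abs p (Y m - Y n)
                  + padic_abs p (X m - X n) * padic_abs p (Y n)"
      by (metis padic_abs_facts(1) padic_abs_facts(2))
    also have "\<dots> \<le> A * padic_abs p (Y m - Y n) + padic_abs p (X m - X n) * B"
      by (intro add_mono mult_right_mono mult_left_mono A B padic_abs_nonneg)
    also have "\<dots> < A * (e / (2 * A)) + (e / (2 * B)) * B"
      using i[of m n] j[of m n] that A B
      by (intro add_strict_mono mult_strict_left_mono mult_strict_right_mono) auto
    also have "\<dots> = e" using A B by (simp add: field_simps)
    finally show ?thesis .
  qed
  then show "\<exists>k. \<forall>m\<ge>k. \<forall>n\<ge>k. padic_abs p (X m * Y m - X n * Y n) < e" by blast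
qed

lemma padic_cauchy_not_null:
  assumes X: "padic_cauchy p X" and nz: "\<not> padic_null p X"
  obtains b k where "b > 0" "\<And>n. n \<ge> k \<Longrightarrow> padic_abs p (X n) > b"
proof -
  obtain L where L: "(\<lambda>n. padic_abs p (X n)) \<longlonglongrightarrow> L"
    using padic_cauchy_abs_convergent[OF X] by (auto simp: convergent_def)
  have "L \<ge> 0" by (rule LIMSEQ_le_const[OF L]) auto
  moreover have "L \<noteq> 0" using nz L by (auto simp: padic_null_def)
  ultimately have "L / 2 > 0" "L / 2 < L" by auto
  moreover from this have "\<forall>\<^sub>F n in sequentially. L / 2 < padic_abs p (X n)"
    using order_tendstoD(1)[OF L] by blast
  ultimately show ?thesis using that unfolding eventually_sequentially by blast
qed

lemma padic_abs_inverse_diff: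
  assumes "b > 0" "padic_abs p x > b" "padic_abs p y > b"
  shows "padic_abs p (inverse x - inverse y) \<le> padic_abs p (x - y) / b\<^sup>2"
proof -
  have nz: "x \<noteq> 0" "y \<noteq> 0" using assms by auto
  have "inverse x - inverse y = - (inverse x * (x - y) * inverse y)"
    using nz by (rule inverse_diff_inverse)
  hence "padic_abs p (inverse x - inverse y)
      = padic_abs p (x - y) * (inverse (padic_abs p x) * inverse (padic_abs p y))"
    by (simp add: padic_abs_facts padic_abs_inverse[OF prime_p])
  also have "\<dots> \<le> padic_abs p (x - y) * (inverse b * inverse b)"
    using assms by (intro mult_left_mono mult_mono le_imp_inverse_le) auto
  also have "\<dots> = padic_abs p (x - y) / b\<^sup>2"
    by (simp add: power2_eq_square divide_inverse)
  finally show ?thesis .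
qed

lemma padic_cauchy_inverse:
  assumes X: "padic_cauchy p X" and nz: "\<not> padic_null p X"
  shows "padic_cauchy p (\<lambda>n. inverse (X n))"
  unfolding padic_cauchy_def
proof (intro allI impI)
  fix e :: real assume e: "e > 0"
  obtain b i where b: "b > 0" and i: "\<And>n. n \<ge> i \<Longrightarrow> padic_abs p (X n) > b"
    using padic_cauchy_not_null[OF X nz] by blast
  have "e * b\<^sup>2 > 0" using e b by simp
  then obtain j where j: "\<And>m n. m \<ge> j \<Longrightarrow> n \<ge> j \<Longrightarrow> padic_abs p (X m - X n) < e * b\<^sup>2"
    using X unfolding padic_cauchy_def by blast
  have "padic_abs p (inverse (X m) - inverse (X n)) < e" if "m \<ge> max i j" "n \<ge> max i j" for m n
  proof -
    have "padic_abs p (inverse (X m) - inverse (X n)) \<le> padic_abs p (X m - X n) / b\<^sup>2"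
      using b i that by (intro padic_abs_inverse_diff) auto
    also have "\<dots> < e" using j[of m n] that b by (simp add: divide_less_eq)
    finally show ?thesis .
  qed
  then show "\<exists>k. \<forall>m\<ge>k. \<forall>n\<ge>k. padic_abs p (inverse (X m) - inverse (X n)) < e" by blast
qed

lemma padic_null_diff_inverse:
  assumes X: "padic_cauchy p X" "\<not> padic_null p X"
    and Y: "padic_cauchy p Y" "\<not> padic_null p Y"
    and XY: "padic_null p (\<lambda>n. X n - Y n)"
  shows "padic_null p (\<lambda>n. inverse (X n) - inverse (Y n))"
proof -
  obtain a i where a: "a > 0" and i: "\<And>n. n \<ge> i \<Longrightarrow> padic_abs p (X n) > a"
    using padic_cauchy_not_null[OF X] by blast
  obtain b j where b: "b > 0" and j: "\<And>n. n \<ge> j \<Longrightarrow> padic_abs p (Y n) > b"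
    using padic_cauchy_not_null[OF Y] by blast
  let ?c = "min a b"
  have lim: "(\<lambda>n. padic_abs p (X n - Y n) / ?c\<^sup>2) \<longlonglongrightarrow> 0"
    using tendsto_divide[OF XY[unfolded padic_null_def] tendsto_const[of "?c\<^sup>2"]] a b
    by (simp add: min_def)
  have ev: "\<forall>\<^sub>F n in sequentially.
      padic_abs p (inverse (X n) - inverse (Y n)) \<le> padic_abs p (X n - Y n) / ?c\<^sup>2"
    unfolding eventually_sequentially
  proof (intro exI[of _ "max i j"] allI impI)
    fix n assume n: "n \<ge> max i j"
    show "padic_abs p (inverse (X n) - inverse (Y n)) \<le> padic_abs p (X n - Y n) / ?c\<^sup>2"
      using a b i[of n] j[of n] n by (intro padic_abs_inverse_diff) auto
  qed
  show ?thesis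
    unfolding padic_null_def
    by (rule tendsto_sandwich[OF _ ev tendsto_const lim]) simp
qed

lemma padic_null_diff_iff:
  assumes "padic_null p (\<lambda>n. X n - Y n)"
  shows "padic_null p X \<longleftrightarrow> padic_null p Y"
  using padic_null_add[OF assms, of Y] padic_null_add[OF padic_null_minus[OF assms], of X] by auto

lemma padic_rel_refl: "padic_cauchy p X \<Longrightarrow> padic_rel p X X"
  by (simp add: padic_rel_def)

lemma part_equivp_padic_rel: "part_equivp (padic_rel p)"
proof (rule part_equivpI)
  show "\<exists>X. padic_rel p X X" using padic_rel_refl padic_cauchy_const by blast
  show "symp (padic_rel p)"
    by (auto simp: symp_def padic_rel_def padic_null_def padic_abs_diff_commute)
  show "transp (padic_rel p)"
  proof (rule transpI)
    fix X Y Z assume "padic_rel p X Y" "padic_rel p Y Z"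
    then show "padic_rel p X Z"
      using padic_null_add[of "\<lambda>n. X n - Y n" "\<lambda>n. Y n - Z n"] by (simp add: padic_rel_def)
  qed
qed

lemma padic_rel_lim_abs:
  assumes "padic_rel p X Y"
  shows "lim (\<lambda>n. padic_abs p (X n)) = lim (\<lambda>n. padic_abs p (Y n))"
proof -
  obtain L where L: "(\<lambda>n. padic_abs p (X n)) \<longlonglongrightarrow> L"
    using padic_cauchy_abs_convergent assms by (auto simp: padic_rel_def convergent_def)
  have "(\<lambda>n. padic_abs p (Y n) - padic_abs p (X n)) \<longlonglongrightarrow> 0"
  proof (rule Lim_null_comparison)
    show "\<forall>\<^sub>F n in sequentially. norm (padic_abs p (Y n) - padic_abs p (X n)) \<le> padic_abs p (X n - Y n)"
      using padic_abs_diff_abs by (intro always_eventually allI) (metis padic_abs_diff_commute real_norm_def)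
    show "(\<lambda>n. padic_abs p (X n - Y n)) \<longlonglongrightarrow> 0"
      using assms by (simp add: padic_rel_def padic_null_def)
  qed
  from tendsto_add[OF this L] have "(\<lambda>n. padic_abs p (Y n)) \<longlonglongrightarrow> L" by simp
  from limI[OF this] limI[OF L] show ?thesis by simp
qed

end

text \<open>
  The prime is carried by the type: \<open>'p\<close> ranges over the types with a prime number of elements,
  and \<open>CARD('p)\<close> is the prime \<open>p\<close>.
\<close>

class prime_card = finite +
  assumes prime_card: "prime CARD('a)"

typedef (overloaded) 'p padic_seq = "{X. padic_cauchy CARD('p::prime_card) X}"
  morphisms seq_of Padic_seq
  using padic_cauchy_const by blast

setup_lifting type_definition_padic_seq

lift_definition seq_const :: "rat \<Rightarrow> 'p::prime_card padic_seq" is "\<lambda>c n. c"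
  by simp

lift_definition seq_uminus :: "'p::prime_card padic_seq \<Rightarrow> 'p padic_seq" is "\<lambda>X n. - X n"
  by (rule padic_cauchy_minus)

lift_definition seq_plus :: "'p::prime_card padic_seq \<Rightarrow> 'p padic_seq \<Rightarrow> 'p padic_seq"
  is "\<lambda>X Y n. X n + Y n"
  by (rule padic_cauchy_add[OF prime_card])

lift_definition seq_times :: "'p::prime_card padic_seq \<Rightarrow> 'p padic_seq \<Rightarrow> 'p padic_seq"
  is "\<lambda>X Y n. X n * Y n"
  by (rule padic_cauchy_mult[OF prime_card])

lift_definition seq_inverse :: "'p::prime_card padic_seq \<Rightarrow> 'p padic_seq"
  is "\<lambda>X. if padic_null CARD('p) X then (\<lambda>n. 0) else (\<lambda>n. inverse (X n))"
  using padic_cauchy_inverse[OF prime_card] by auto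

lift_definition seq_lim_abs :: "'p::prime_card padic_seq \<Rightarrow> real"
  is "\<lambda>X. lim (\<lambda>n. padic_abs CARD('p) (X n))" .

lift_definition seq_rel :: "'p::prime_card padic_seq \<Rightarrow> 'p padic_seq \<Rightarrow> bool"
  is "\<lambda>X Y. padic_null CARD('p) (\<lambda>n. X n - Y n)" .

quotient_type (overloaded) 'p padic = "'p::prime_card padic_seq" / seq_rel
proof (rule equivpI)
  show "reflp (seq_rel :: 'p padic_seq \<Rightarrow> _)"
    by (rule reflpI, transfer) simp
  show "symp (seq_rel :: 'p padic_seq \<Rightarrow> _)"
    by (rule sympI, transfer) (simp add: padic_null_def padic_abs_diff_commute)
  show "transp (seq_rel :: 'p padic_seq \<Rightarrow> _)"
  proof (rule transpI, transfer)
    fix X Y Z :: "nat \<Rightarrow> rat"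
    assume "padic_null CARD('p) (\<lambda>n. X n - Y n)" "padic_null CARD('p) (\<lambda>n. Y n - Z n)"
    from padic_null_add[OF prime_card this] show "padic_null CARD('p) (\<lambda>n. X n - Z n)" by simp
  qed
qed

instantiation padic :: (prime_card) field
begin

lift_definition zero_padic :: "'a padic" is "seq_const 0" .

lift_definition one_padic :: "'a padic" is "seq_const 1" .

lift_definition uminus_padic :: "'a padic \<Rightarrow> 'a padic" is seq_uminus
proof transfer
  fix X Y :: "nat \<Rightarrow> rat"
  assume "padic_null CARD('a) (\<lambda>n. X n - Y n)"
  from padic_null_minus[OF this] show "padic_null CARD('a) (\<lambda>n. - X n - - Y n)"
    by simp
qed

lift_definition plus_padic :: "'a padic \<Rightarrow> 'a padic \<Rightarrow> 'a padic" is seq_plus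
proof transfer
  fix X Y Z W :: "nat \<Rightarrow> rat"
  assume "padic_null CARD('a) (\<lambda>n. X n - Y n)" "padic_null CARD('a) (\<lambda>n. Z n - W n)"
  from padic_null_add[OF prime_card this]
  show "padic_null CARD('a) (\<lambda>n. X n + Z n - (Y n + W n))" by (simp add: algebra_simps)
qed

lift_definition times_padic :: "'a padic \<Rightarrow> 'a padic \<Rightarrow> 'a padic" is seq_times
proof transfer
  fix X Y Z W :: "nat \<Rightarrow> rat"
  assume *: "padic_cauchy CARD('a) X" "padic_cauchy CARD('a) W"
    "padic_null CARD('a) (\<lambda>n. X n - Y n)" "padic_null CARD('a) (\<lambda>n. Z n - W n)"
  have "padic_null CARD('a) (\<lambda>n. X n * (Z n - W n) + W n * (X n - Y n))"
    by (intro padic_null_add padic_null_mult prime_card *)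
  then show "padic_null CARD('a) (\<lambda>n. X n * Z n - Y n * W n)" by (simp add: algebra_simps)
qed

lift_definition inverse_padic :: "'a padic \<Rightarrow> 'a padic" is seq_inverse
proof transfer
  fix X Y :: "nat \<Rightarrow> rat"
  assume "padic_cauchy CARD('a) X" "padic_cauchy CARD('a) Y" "padic_null CARD('a) (\<lambda>n. X n - Y n)"
  then show "padic_null CARD('a) (\<lambda>n. (if padic_null CARD('a) X then \<lambda>n. 0 else (\<lambda>n. inverse (X n))) n
      - (if padic_null CARD('a) Y then \<lambda>n. 0 else (\<lambda>n. inverse (Y n))) n)"
    using padic_null_diff_iff[OF prime_card, of X Y] padic_null_diff_inverse[OF prime_card, of X Y]
    by auto
qed

definition "x - y = x + - (y :: 'a padic)"

definition "x div y = x * inverse (y :: 'a padic)"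

lemma padic_inverse_mult: "a \<noteq> 0 \<Longrightarrow> inverse a * a = (1 :: 'a padic)"
proof (transfer, transfer)
  fix X :: "nat \<Rightarrow> rat"
  assume X: "padic_cauchy CARD('a) X" and "\<not> padic_null CARD('a) (\<lambda>n. X n - 0)"
  hence nz: "\<not> padic_null CARD('a) X" by simp
  obtain b k where bk: "b > 0" "\<And>n. n \<ge> k \<Longrightarrow> padic_abs CARD('a) (X n) > b"
    using padic_cauchy_not_null[OF prime_card X nz] by blast
  have "\<forall>\<^sub>F n in sequentially. padic_abs CARD('a) (inverse (X n) * X n - 1) = 0"
    unfolding eventually_sequentially
  proof (intro exI[of _ k] allI impI)
    fix n assume "n \<ge> k"
    with bk have "X n \<noteq> 0" by force
    then show "padic_abs CARD('a) (inverse (X n) * X n - 1) = 0" by simp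
  qed
  hence "padic_null CARD('a) (\<lambda>n. inverse (X n) * X n - 1)"
    unfolding padic_null_def by (rule tendsto_eventually)
  then show "padic_null CARD('a)
      (\<lambda>n. (if padic_null CARD('a) X then \<lambda>n. 0 else (\<lambda>n. inverse (X n))) n * X n - 1)"
    using nz by simp
qed

instance
proof
  fix a b c :: "'a padic"
  show "a * b * c = a * (b * c)" by transfer (transfer, simp add: mult.assoc)
  show "a * b = b * a" by transfer (transfer, simp add: mult.commute)
  show "1 * a = a" by transfer (transfer, simp)
  show "a + b + c = a + (b + c)" by transfer (transfer, simp add: add.assoc)
  show "a + b = b + a" by transfer (transfer, simp add: add.commute)
  show "0 + a = a" by transfer (transfer, simp)
  show "- a + a = 0" by transfer (transfer, simp)
  show "a - b = a + - b" by (fact minus_padic_def)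
  show "(a + b) * c = a * c + b * c" by transfer (transfer, simp add: distrib_right)
  show "(0::'a padic) \<noteq> 1" by transfer (transfer, simp add: padic_null_def LIMSEQ_const_iff)
  show "a div b = a * inverse b" by (fact divide_padic_def)
  show "inverse (0::'a padic) = 0" by transfer (transfer, simp)
  show "a \<noteq> 0 \<Longrightarrow> inverse a * a = 1" by (rule padic_inverse_mult)
qed

end

lift_definition padic_norm :: "'p::prime_card padic \<Rightarrow> real" is seq_lim_abs
proof transfer
  fix X Y :: "nat \<Rightarrow> rat"
  assume "padic_cauchy CARD('p) X" "padic_cauchy CARD('p) Y" "padic_null CARD('p) (\<lambda>n. X n - Y n)"
  then show "lim (\<lambda>n. padic_abs CARD('p) (X n)) = lim (\<lambda>n. padic_abs CARD('p) (Y n))"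
    by (intro padic_rel_lim_abs[OF prime_card]) (simp add: padic_rel_def)
qed

lemma padic_cauchy_lim:
  assumes "padic_cauchy CARD('p::prime_card) X"
  shows "(\<lambda>n. padic_abs CARD('p) (X n)) \<longlonglongrightarrow> lim (\<lambda>n. padic_abs CARD('p) (X n))"
  using padic_cauchy_abs_convergent[OF prime_card assms] by (simp add: convergent_LIMSEQ_iff)

lemma padic_norm_eq_0_iff: "padic_norm (x :: 'p::prime_card padic) = 0 \<longleftrightarrow> x = 0"
proof (transfer, transfer)
  fix X :: "nat \<Rightarrow> rat" assume "padic_cauchy CARD('p) X"
  from padic_cauchy_lim[OF this]
  show "lim (\<lambda>n. padic_abs CARD('p) (X n)) = 0 \<longleftrightarrow> padic_null CARD('p) (\<lambda>n. X n - 0)"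
    by (auto simp: padic_null_def dest: limI)
qed

lemma padic_norm_minus: "padic_norm (- x :: 'p::prime_card padic) = padic_norm x"
  by transfer (transfer, simp)

lemma padic_norm_mult: "padic_norm (x * y :: 'p::prime_card padic) = padic_norm x * padic_norm y"
proof (transfer, transfer)
  fix X Y :: "nat \<Rightarrow> rat" assume XY: "padic_cauchy CARD('p) X" "padic_cauchy CARD('p) Y"
  show "lim (\<lambda>n. padic_abs CARD('p) (X n * Y n))
      = lim (\<lambda>n. padic_abs CARD('p) (X n)) * lim (\<lambda>n. padic_abs CARD('p) (Y n))"
    unfolding padic_abs_mult[OF prime_card]
    by (rule limI, rule tendsto_mult[OF XY[THEN padic_cauchy_lim]])
qed

lemma padic_norm_add_le_max: "padic_norm (x + y :: 'p::prime_card padic) \<le> max (padic_norm x) (padic_norm y)"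
proof (transfer, transfer)
  fix X Y :: "nat \<Rightarrow> rat" assume XY: "padic_cauchy CARD('p) X" "padic_cauchy CARD('p) Y"
  show "lim (\<lambda>n. padic_abs CARD('p) (X n + Y n))
      \<le> max (lim (\<lambda>n. padic_abs CARD('p) (X n))) (lim (\<lambda>n. padic_abs CARD('p) (Y n)))"
    by (rule LIMSEQ_le[OF padic_cauchy_lim[OF padic_cauchy_add[OF prime_card XY]]
          tendsto_max[OF XY[THEN padic_cauchy_lim]]])
      (auto intro: padic_abs_add_le_max[OF prime_card])
qed

lemma padic_norm_nonneg: "padic_norm (x :: 'p::prime_card padic) \<ge> 0"
  using padic_norm_add_le_max[of x "- x"] padic_norm_eq_0_iff[of "0 :: 'p padic"]
  by (simp add: padic_norm_minus)

lemma padic_norm_of_nat: "padic_norm (of_nat n :: 'p::prime_card padic) = padic_abs CARD('p) (of_nat n)"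
proof -
  have eq: "of_nat n = (abs_padic (seq_const (of_nat n)) :: 'p padic)"
  proof (induction n)
    case 0
    then show ?case by (simp add: zero_padic.abs_eq)
  next
    case (Suc n)
    have "seq_plus (seq_const 1) (seq_const (of_nat n)) = (seq_const (of_nat (Suc n)) :: 'p padic_seq)"
      by transfer simp
    then show ?case by (simp add: Suc one_padic.abs_eq plus_padic.abs_eq)
  qed
  have "seq_lim_abs (seq_const c :: 'p padic_seq) = padic_abs CARD('p) c" for c
    by transfer simp
  then show ?thesis by (simp add: eq padic_norm.abs_eq)
qed

lemma padic_norm_p: "padic_norm (of_nat CARD('p) :: 'p::prime_card padic) = 1 / real CARD('p)"
proof -
  have p: "prime CARD('p)" by (rule prime_card)
  have "multiplicity (int CARD('p)) (int CARD('p)) = 1"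
    using prime_gt_1_nat[OF p] by (intro multiplicity_self) auto
  then have "padic_abs CARD('p) (of_nat CARD('p)) = 1 / real CARD('p)"
    using padic_abs_frac[OF p, of "int CARD('p)" 1] prime_gt_1_nat[OF p]
    by (simp add: power_int_minus divide_inverse)
  then show ?thesis by (simp add: padic_norm_of_nat)
qed

instantiation padic :: (prime_card) metric_space
begin

definition "dist x y = padic_norm (x - y :: 'a padic)"

definition uniformity_padic_def [code del]:
  "(uniformity :: ('a padic \<times> 'a padic) filter) = (INF e\<in>{0<..}. principal {(x, y). dist x y < e})"

definition open_padic_def [code del]:
  "open (U :: 'a padic set) \<longleftrightarrow> (\<forall>x\<in>U. eventually (\<lambda>(x', y). x' = x \<longrightarrow> y \<in> U) uniformity)"

instance
proof
  fix x y z :: "'a padic"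
  show "dist x y = 0 \<longleftrightarrow> x = y" by (simp add: dist_padic_def padic_norm_eq_0_iff)
  show "dist x y \<le> dist x z + dist y z"
    using padic_norm_add_le_max[of "x - z" "z - y"] padic_norm_minus[of "y - z"]
      padic_norm_nonneg[of "x - z"] padic_norm_nonneg[of "y - z"]
    by (simp add: dist_padic_def)
qed (simp_all add: dist_padic_def uniformity_padic_def open_padic_def)

end

section \<open>Balls, shifts, characters and the Fourier transform\<close>

definition padic_ball :: "int \<Rightarrow> 'p::prime_card padic \<Rightarrow> 'p padic set" where
  "padic_ball \<gamma> a = {x. padic_norm (x - a) \<le> real CARD('p) powi \<gamma>}"

definition shift_set :: "'p::prime_card padic set" where
  "shift_set = {of_nat CARD('p) powi (- int \<gamma>) * (\<Sum>j<\<gamma>. of_nat (a j) * of_nat CARD('p) ^ j) |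
                  (\<gamma> :: nat) (a :: nat \<Rightarrow> nat). \<forall>j. a j < CARD('p)}"

text \<open>
  \<open>{x}\<^sub>p\<close> is the part with negative exponents of the canonical expansion
  \<open>x = \<Sum>\<^sub>k a\<^sub>k p\<^sup>k\<^sup>-\<^sup>\<gamma>\<close>, read as a real number. Leading zeros are allowed, so that
  every \<open>x\<close> has an expansion for some natural \<open>\<gamma>\<close>.
\<close>

definition frac_part :: "'p::prime_card padic \<Rightarrow> real" where
  "frac_part x = (THE r. \<exists>(\<gamma> :: nat) (a :: nat \<Rightarrow> nat).
      (\<forall>k. a k < CARD('p)) \<and>
      (\<lambda>k. of_nat (a k) * of_nat CARD('p) powi (int k - int \<gamma>)) sums x \<and>
      r = (\<Sum>k<\<gamma>. real (a k) * real CARD('p) powi (int k - int \<gamma>)))"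

definition padic_char :: "'p::prime_card padic \<Rightarrow> complex" where
  "padic_char x = exp (2 * of_real pi * \<i> * of_real (frac_part x))"

text \<open>
  The Haar measure is the unique translation-invariant Borel measure that gives the unit disc
  measure 1; it is characterised by these properties rather than constructed.
\<close>

definition normalized_haar :: "'p::prime_card padic measure \<Rightarrow> bool" where
  "normalized_haar \<mu> \<longleftrightarrow> sets \<mu> = sets borel \<and>
     (\<forall>a. \<forall>A\<in>sets \<mu>. emeasure \<mu> ((+) a ` A) = emeasure \<mu> A) \<and>
     emeasure \<mu> {x. padic_norm x \<le> 1} = 1"

definition fourier ::
  "'p::prime_card padic measure \<Rightarrow> ('p padic \<Rightarrow> complex) \<Rightarrow> 'p padic \<Rightarrow> complex" where
  "fourier \<mu> \<phi> \<xi> = (\<integral>x. padic_char (\<xi> * x) * \<phi> x \<partial>\<mu>)"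


section \<open>Test functions\<close>

definition closed_support :: "('a::topological_space \<Rightarrow> complex) \<Rightarrow> 'a set" where
  "closed_support f = closure {x. f x \<noteq> 0}"

definition test_functions :: "('p::prime_card padic \<Rightarrow> complex) set" where
  "test_functions = {\<phi>. (\<forall>x. \<forall>\<^sub>F y in nhds x. \<phi> y = \<phi> x) \<and> compact (closed_support \<phi>)}"

definition test_functions_NM :: "int \<Rightarrow> int \<Rightarrow> ('p::prime_card padic \<Rightarrow> complex) set" where
  "test_functions_NM N M = {\<phi> \<in> test_functions.
     (\<forall>x. \<phi> (x - of_nat CARD('p) powi M) = \<phi> x) \<and> closed_support \<phi> \<subseteq> padic_ball N 0}"


section \<open>Square-integrable functions and multiresolution analyses\<close>

text \<open>
  Elements of \<open>L\<^sup>2\<close> are represented by square-integrable functions; a closed subspace is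
  the set of all representatives of its elements. A set that contains its \<open>L\<^sup>2\<close>-closure
  is automatically invariant under changes on a null set, and the zero subspace consists of
  the functions that vanish almost everywhere.
\<close>

definition L2 :: "'a measure \<Rightarrow> ('a \<Rightarrow> complex) set" where
  "L2 \<mu> = {f \<in> borel_measurable \<mu>. integrable \<mu> (\<lambda>x. (cmod (f x))\<^sup>2)}"

definition L2_inner :: "'a measure \<Rightarrow> ('a \<Rightarrow> complex) \<Rightarrow> ('a \<Rightarrow> complex) \<Rightarrow> complex" where
  "L2_inner \<mu> f g = (\<integral>x. f x * cnj (g x) \<partial>\<mu>)"

definition L2_norm :: "'a measure \<Rightarrow> ('a \<Rightarrow> complex) \<Rightarrow> real" where
  "L2_norm \<mu> f = sqrt (\<integral>x. (cmod (f x))\<^sup>2 \<partial>\<mu>)"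

definition L2_closure :: "'a measure \<Rightarrow> ('a \<Rightarrow> complex) set \<Rightarrow> ('a \<Rightarrow> complex) set" where
  "L2_closure \<mu> S = {f \<in> L2 \<mu>. \<forall>\<epsilon>>0. \<exists>g\<in>S. L2_norm \<mu> (\<lambda>x. f x - g x) < \<epsilon>}"

definition complex_span :: "('a \<Rightarrow> complex) set \<Rightarrow> ('a \<Rightarrow> complex) set" where
  "complex_span S = {\<lambda>x. \<Sum>g\<in>T. c g * g x | T c. finite T \<and> T \<subseteq> S}"

definition L2_closed_subspace :: "'a measure \<Rightarrow> ('a \<Rightarrow> complex) set \<Rightarrow> bool" where
  "L2_closed_subspace \<mu> V \<longleftrightarrow> V \<subseteq> L2 \<mu> \<and> (\<lambda>x. 0) \<in> V \<and>
     (\<forall>f\<in>V. \<forall>g\<in>V. (\<lambda>x. f x + g x) \<in> V) \<and> (\<forall>c. \<forall>f\<in>V. (\<lambda>x. c * f x) \<in> V) \<and>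
     L2_closure \<mu> V \<subseteq> V"

definition L2_orthonormal_basis ::
  "'a measure \<Rightarrow> ('a \<Rightarrow> complex) set \<Rightarrow> 'i set \<Rightarrow> ('i \<Rightarrow> 'a \<Rightarrow> complex) \<Rightarrow> bool" where
  "L2_orthonormal_basis \<mu> V I e \<longleftrightarrow> (\<forall>a\<in>I. e a \<in> V) \<and>
     (\<forall>a\<in>I. \<forall>b\<in>I. L2_inner \<mu> (e a) (e b) = (if a = b then 1 else 0)) \<and>
     L2_closure \<mu> (complex_span (e ` I)) = V"

definition translate :: "('a::ab_group_add \<Rightarrow> complex) \<Rightarrow> 'a \<Rightarrow> 'a \<Rightarrow> complex" where
  "translate \<phi> a = (\<lambda>x. \<phi> (x - a))"

definition scaling_function_of ::
  "'p::prime_card padic measure \<Rightarrow> (int \<Rightarrow> ('p padic \<Rightarrow> complex) set) \<Rightarrow> ('p padic \<Rightarrow> complex) \<Rightarrow> bool" where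
  "scaling_function_of \<mu> V \<phi> \<longleftrightarrow>
     \<phi> \<in> V 0 \<and> V 0 = L2_closure \<mu> (complex_span (translate \<phi> ` shift_set))"

definition MRA ::
  "'p::prime_card padic measure \<Rightarrow> (int \<Rightarrow> ('p padic \<Rightarrow> complex) set) \<Rightarrow> bool" where
  "MRA \<mu> V \<longleftrightarrow> (\<forall>j. L2_closed_subspace \<mu> (V j)) \<and>
     (\<forall>j. V j \<subseteq> V (j + 1)) \<and>
     L2_closure \<mu> (\<Union>j. V j) = L2 \<mu> \<and>
     (\<Inter>j. V j) = {f \<in> L2 \<mu>. AE x in \<mu>. f x = 0} \<and>
     (\<forall>j f. f \<in> V j \<longleftrightarrow> (\<lambda>x. f (inverse (of_nat CARD('p)) * x)) \<in> V (j + 1)) \<and>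
     (\<exists>\<phi>. scaling_function_of \<mu> V \<phi>)"

definition orthogonal_scaling_function ::
  "'p::prime_card padic measure \<Rightarrow> ('p padic \<Rightarrow> complex) \<Rightarrow> bool" where
  "orthogonal_scaling_function \<mu> \<phi> \<longleftrightarrow>
     (\<exists>V. MRA \<mu> V \<and> scaling_function_of \<mu> V \<phi> \<and>
          L2_orthonormal_basis \<mu> (V 0) shift_set (translate \<phi>))"

end

theory Submission
  imports Defs
begin

text \<open>
  Write \<open>c\<close> for the integral of \<open>\<phi>\<close>. The proof shows that \<open>\<phi>(x - 1) = \<phi>(x)\<close> for almost every
  \<open>x\<close>. A unit period makes the Fourier transform satisfy \<open>F(\<xi>) = \<chi>(-\<xi>) F(\<xi>)\<close>, and \<open>\<chi>(-\<xi>) \<noteq> 1\<close>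
  for \<open>|\<xi>| > 1\<close>, so \<open>F\<close> vanishes off the closed unit ball
  (\<open>fourier_vanishes_outside_unit_ball\<close>).

  The period comes from projecting indicators of balls. Let \<open>n \<ge> max N 0\<close>, let \<open>B\<^sub>n\<close> be the ball of
  radius \<open>p\<^sup>n\<close> around \<open>0\<close>, and let \<open>s\<^sub>n\<close> be the sum of the translates of \<open>\<phi>\<close> by the \<open>p\<^sup>n\<close>
  shifts \<open>k / p\<^sup>n\<close>, \<open>0 \<le> k < p\<^sup>n\<close>, in \<open>B\<^sub>n\<close>. Each of these translates is supported in \<open>B\<^sub>n\<close>, and all
  the others are supported off \<open>B\<^sub>n\<close>. With orthonormality this shows that the projection of the
  indicator of \<open>B\<^sub>n\<close> to \<open>V\<^sub>0\<close> is \<open>s\<^sub>n\<close> times the conjugate of \<open>c\<close>, and that the squared norm of the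
  residual is \<open>p\<^sup>n (1 - |c|\<^sup>2)\<close> (\<open>residual_norm\<close>).

  This quantity grows with \<open>n\<close> at the same rate as squared norms grow under dilation. Dilating by
  \<open>p\<^sup>j\<close> therefore turns it into a lower bound, independent of \<open>j\<close>, for the distance of one fixed
  indicator to all the spaces \<open>V\<^sub>j\<close>. Since their union is dense, \<open>|c| \<ge> 1\<close>
  (\<open>cmod_integral_ge_1\<close>). The residual is then zero, so \<open>s\<^sub>n\<close> is a multiple of the indicator of
  \<open>B\<^sub>n\<close> and is invariant under translation by \<open>p\<^sup>-\<^sup>n\<close>. The difference
  \<open>s\<^sub>n(x - p\<^sup>-\<^sup>n) - s\<^sub>n(x)\<close> telescopes to \<open>\<phi>(x - 1) - \<phi>(x)\<close>, which gives the period
  (\<open>AE_unit_periodic\<close>).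

  Two facts about the p-adic numbers support this. The map \<open>\<chi>\<close> is a character that equals \<open>1\<close>
  exactly on the unit ball; this rests on the digit expansion. Haar measure scales by \<open>p\<^sup>j\<close> under
  multiplication by \<open>p\<^sup>j\<close>; this follows from its values on balls, which generate the Borel sets.
\<close>

section \<open>The norm on integers, and residue digits\<close>

abbreviation uniformizer :: "'p::prime_card padic" where
  "uniformizer \<equiv> of_nat CARD('p)"

lemma prime_card_gt_1: "1 < real CARD('p::prime_card)"
  using prime_gt_1_nat[OF prime_card[where ?'a='p]] by simp

lemma padic_norm_0 [simp]: "padic_norm (0 :: 'p::prime_card padic) = 0"
  by (simp add: padic_norm_eq_0_iff)

lemma padic_norm_1 [simp]: "padic_norm (1 :: 'p::prime_card padic) = 1"
  using padic_norm_of_nat[of 1, where ?'p='p] by simp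

lemma uniformizer_nonzero [simp]: "(uniformizer :: 'p::prime_card padic) \<noteq> 0"
  using padic_norm_p[where ?'p='p] prime_card_gt_1[where ?'p='p]
  by (auto simp flip: padic_norm_eq_0_iff)

lemma padic_norm_diff_commute: "padic_norm (x - y :: 'p::prime_card padic) = padic_norm (y - x)"
  by (metis minus_diff_eq padic_norm_minus)

lemma padic_norm_inverse: "padic_norm (inverse x :: 'p::prime_card padic) = inverse (padic_norm x)"
proof (cases "x = 0")
  case False
  then have "padic_norm x * padic_norm (inverse x) = 1"
    by (simp flip: padic_norm_mult)
  then show ?thesis by (metis inverse_unique)
qed simp

lemma padic_norm_divide: "padic_norm (x / y :: 'p::prime_card padic) = padic_norm x / padic_norm y"
  by (simp add: divide_inverse padic_norm_mult padic_norm_inverse)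

lemma padic_norm_power: "padic_norm (x ^ n :: 'p::prime_card padic) = padic_norm x ^ n"
  by (induction n) (auto simp: padic_norm_mult)

lemma padic_norm_uniformizer_powi:
  "padic_norm (uniformizer powi n :: 'p::prime_card padic) = real CARD('p) powi (- n)"
  by (cases "n \<ge> 0")
    (simp_all add: power_int_def padic_norm_power padic_norm_inverse padic_norm_p power_one_over divide_inverse power_inverse)

lemma padic_norm_uniformizer_power:
  "padic_norm (uniformizer ^ n :: 'p::prime_card padic) = real CARD('p) powi (- int n)"
  using padic_norm_uniformizer_powi[of "int n", where ?'p='p] by simp

lemma padic_norm_add_le:
  fixes x y :: "'p::prime_card padic"
  assumes "padic_norm x \<le> r" "padic_norm y \<le> r"
  shows "padic_norm (x + y) \<le> r"
  using padic_norm_add_le_max[of x y] assms by linarith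

lemma padic_norm_diff_le:
  fixes x y :: "'p::prime_card padic"
  assumes "padic_norm x \<le> r" "padic_norm y \<le> r"
  shows "padic_norm (x - y) \<le> r"
  using padic_norm_add_le[of x r "- y"] assms by (simp add: padic_norm_minus)

lemma padic_norm_scaled_le_iff:
  fixes x :: "'p::prime_card padic"
  shows "padic_norm (uniformizer powi m * x) \<le> real CARD('p) powi (g - m)
      \<longleftrightarrow> padic_norm x \<le> real CARD('p) powi g"
proof -
  have "real CARD('p) powi (g - m) = real CARD('p) powi (- m) * real CARD('p) powi g"
    using prime_card_gt_1[where ?'p='p] by (simp add: power_int_add[symmetric])
  then show ?thesis
    using prime_card_gt_1[where ?'p='p] by (simp add: padic_norm_mult padic_norm_uniformizer_powi)
qed

lemma padic_norm_of_int_le_1: "padic_norm (of_int k :: 'p::prime_card padic) \<le> 1"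
proof -
  have nat: "padic_norm (of_nat m :: 'p padic) \<le> 1" for m
    by (induction m) (auto intro: padic_norm_add_le)
  then show ?thesis
    by (cases k) (auto simp: padic_norm_minus simp del: of_nat_Suc)
qed

text \<open>
  A Bezout identity \<open>a p + b k = 1\<close> writes \<open>1\<close> as a sum with first summand of norm below
  \<open>1\<close>, so the ultrametric inequality forces \<open>|b k| \<ge> 1\<close>.
\<close>

lemma padic_norm_of_int_eq_1:
  assumes "\<not> int CARD('p::prime_card) dvd k"
  shows "padic_norm (of_int k :: 'p padic) = 1"
proof -
  have "coprime (int CARD('p)) k"
    using assms prime_card[where ?'a='p] by (simp add: prime_imp_coprime)
  then obtain a b where "a * int CARD('p) + b * k = 1"
    by (metis coprime_iff_gcd_eq_1 bezout_int)
  then have "of_int (a * int CARD('p) + b * k) = (1 :: 'p padic)" by simp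
  then have eq: "of_int a * uniformizer + of_int b * of_int k = (1 :: 'p padic)" by simp
  have "padic_norm (of_int a * uniformizer :: 'p padic) < 1"
    using padic_norm_of_int_le_1[of a, where ?'p='p] prime_card_gt_1[where ?'p='p]
    by (simp add: padic_norm_mult padic_norm_p)
  then have "1 \<le> padic_norm (of_int b * of_int k :: 'p padic)"
    using padic_norm_add_le_max[of "of_int a * uniformizer" "of_int b * of_int k :: 'p padic"]
    by (auto simp: eq)
  also have "\<dots> \<le> padic_norm (of_int k :: 'p padic)"
    using padic_norm_of_int_le_1[of b, where ?'p='p] padic_norm_nonneg[of "of_int k :: 'p padic"]
    by (simp add: padic_norm_mult mult_left_le_one_le padic_norm_nonneg)
  finally show ?thesis using padic_norm_of_int_le_1[of k, where ?'p='p] by simp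
qed

lemma power_dvd_if_padic_norm_le:
  assumes "padic_norm (of_int k :: 'p::prime_card padic) \<le> real CARD('p) powi (- int n)"
  shows "int CARD('p) ^ n dvd k"
  using assms
proof (induction n arbitrary: k)
  case (Suc n)
  have lt: "real CARD('p) powi (- int (Suc n)) < 1"
    using one_less_power[OF prime_card_gt_1[where ?'p='p], of "Suc n"]
    by (simp add: power_int_minus inverse_less_1_iff del: power_Suc of_nat_Suc)
  then have "int CARD('p) dvd k"
    using Suc.prems padic_norm_of_int_eq_1[of k, where ?'p='p] by fastforce
  then obtain l where k: "k = int CARD('p) * l" by (auto elim: dvdE)
  have "padic_norm (uniformizer powi 1 * of_int l :: 'p padic) \<le> real CARD('p) powi (- int n - 1)"
    using Suc.prems by (simp add: k minus_diff_commute)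
  then have "padic_norm (of_int l :: 'p padic) \<le> real CARD('p) powi (- int n)"
    by (simp only: padic_norm_scaled_le_iff)
  with Suc.IH k show ?case by simp
qed simp

lemma padic_of_int_eq_0_iff: "of_int k = (0 :: 'p::prime_card padic) \<longleftrightarrow> k = 0"
proof
  assume "of_int k = (0 :: 'p padic)"
  then have dvd: "int CARD('p) ^ nat \<bar>k\<bar> dvd k"
    using prime_card_gt_1[where ?'p='p] by (intro power_dvd_if_padic_norm_le) simp
  have "nat \<bar>k\<bar> < CARD('p) ^ nat \<bar>k\<bar>"
    using prime_card_gt_1[where ?'p='p] by (intro power_gt_expt) simp
  then have "\<bar>k\<bar> < int (CARD('p) ^ nat \<bar>k\<bar>)" by linarith
  then have "\<bar>k\<bar> < \<bar>int CARD('p) ^ nat \<bar>k\<bar>\<bar>" by simp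
  then show "k = 0" using dvd dvd_imp_le_int[of k "int CARD('p) ^ nat \<bar>k\<bar>"] by linarith
qed simp

lemma const_mult: "(abs_padic (seq_const (x * y)) :: 'p::prime_card padic)
    = abs_padic (seq_const x) * abs_padic (seq_const y)"
proof -
  have "seq_const (x * y) = (seq_times (seq_const x) (seq_const y) :: 'p padic_seq)"
    by transfer simp
  then show ?thesis by (simp add: times_padic.abs_eq)
qed

lemma const_of_int: "(abs_padic (seq_const (of_int k)) :: 'p::prime_card padic) = of_int k"
proof -
  have add: "(abs_padic (seq_const (x + y)) :: 'p padic)
      = abs_padic (seq_const x) + abs_padic (seq_const y)" for x y
  proof -
    have "seq_const (x + y) = (seq_plus (seq_const x) (seq_const y) :: 'p padic_seq)"
      by transfer simp
    then show ?thesis by (simp add: plus_padic.abs_eq)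
  qed
  have nat: "(abs_padic (seq_const (of_nat n)) :: 'p padic) = of_nat n" for n
    by (induction n) (simp_all add: add one_padic.abs_eq zero_padic.abs_eq)
  have "(abs_padic (seq_const (- of_nat n)) :: 'p padic) = - of_nat n" for n
    using add[of "of_nat n" "- of_nat n"] nat[of n]
    by (simp add: zero_padic.abs_eq[symmetric] eq_neg_iff_add_eq_0 add.commute)
  with nat show ?thesis by (cases k rule: int_cases2) auto
qed

text \<open>
  A p-adic number is approximated by the terms of any Cauchy sequence that represents it.
\<close>

lemma seq_const_dense:
  fixes Y :: "'p::prime_card padic_seq"
  assumes "e > 0"
  shows "\<exists>q. seq_lim_abs (seq_plus Y (seq_uminus (seq_const q))) < e"
  using assms
proof transfer
  fix X :: "nat \<Rightarrow> rat" and e :: real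
  assume X: "padic_cauchy CARD('p) X" and e: "e > 0"
  then obtain k where k: "\<And>m n. m \<ge> k \<Longrightarrow> n \<ge> k \<Longrightarrow> padic_abs CARD('p) (X m - X n) < e / 2"
    unfolding padic_cauchy_def by (meson half_gt_zero)
  have "padic_cauchy CARD('p) (\<lambda>n. X n + - X k)"
    using padic_cauchy_add[OF prime_card X padic_cauchy_const] .
  from padic_cauchy_lim[OF this]
  have "lim (\<lambda>n. padic_abs CARD('p) (X n + - X k)) \<le> e / 2"
    by (rule LIMSEQ_le_const2) (use k less_imp_le in \<open>auto intro!: exI[of _ k]\<close>)
  with e show "\<exists>q. lim (\<lambda>n. padic_abs CARD('p) (X n + - q)) < e"
    by (intro exI[of _ "X k"]) auto
qed

lemma rational_dense:
  fixes x :: "'p::prime_card padic"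
  assumes "e > 0"
  obtains a b where "b \<noteq> 0" "coprime a b" "padic_norm (x - of_int a / of_int b) < e"
proof -
  obtain Y where Y: "x = abs_padic Y"
    using Quotient_abs_rep[OF Quotient_padic] by metis
  have "\<exists>q. seq_lim_abs (seq_plus Y (seq_uminus (seq_const q))) < e"
    using assms by (rule seq_const_dense)
  then have "\<exists>q. padic_norm (x - abs_padic (seq_const q)) < e"
    by (simp add: Y minus_padic_def uminus_padic.abs_eq plus_padic.abs_eq padic_norm.abs_eq)
  then obtain q where q: "padic_norm (x - abs_padic (seq_const q)) < e" by blast
  obtain a b where ab: "quotient_of q = (a, b)" by (cases "quotient_of q")
  have b: "b > 0" and cop: "coprime a b" and qe: "q = of_int a / of_int b"
    using quotient_of_denom_pos[OF ab] quotient_of_coprime[OF ab] quotient_of_div[OF ab] by auto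
  have "q * of_int b = of_int a" using b qe by simp
  then have eq: "abs_padic (seq_const q) * of_int b = (of_int a :: 'p padic)"
    by (metis const_mult const_of_int)
  have "of_int b \<noteq> (0 :: 'p padic)" using b by (simp add: padic_of_int_eq_0_iff)
  then have "abs_padic (seq_const q) = (of_int a / of_int b :: 'p padic)"
    unfolding eq[symmetric] by (rule nonzero_mult_div_cancel_right[symmetric])
  with q have q': "padic_norm (x - of_int a / of_int b) < e" by (simp only:)
  show ?thesis by (rule that[OF _ cop q']) (use b in simp)
qed

text \<open>
  The digits \<open>0, \<dots>, p - 1\<close> represent the residue field. A rational \<open>a / b\<close> in lowest terms that is
  close to \<open>x\<close> has \<open>p\<close> prime to \<open>b\<close>, and the digit is the solution of \<open>d b \<equiv> a\<close> modulo \<open>p\<close>.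
\<close>

lemma residue_digit:
  fixes x :: "'p::prime_card padic"
  assumes "padic_norm x \<le> 1"
  obtains d where "d < CARD('p)" "padic_norm ((x - of_nat d) / uniformizer) \<le> 1"
proof -
  let ?p = "int CARD('p)"
  have p1: "real CARD('p) > 1" by (rule prime_card_gt_1)
  then have p_inv: "0 < 1 / real CARD('p)" "1 / real CARD('p) \<le> 1" by auto
  obtain a b where b: "b \<noteq> 0" and cop: "coprime a b"
    and q: "padic_norm (x - of_int a / of_int b) < 1 / real CARD('p)"
    using rational_dense[OF p_inv(1), of x] by metis
  have q1: "padic_norm (of_int a / of_int b :: 'p padic) \<le> 1"
    using padic_norm_diff_le[OF assms, of "x - of_int a / of_int b"] q p_inv by simp
  have "\<not> ?p dvd b"
  proof
    assume pb: "?p dvd b"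
    then have "\<not> ?p dvd a"
      using cop prime_card[where ?'a='p] by (meson coprime_common_divisor not_prime_unit prime_nat_int_transfer)
    then have a1: "padic_norm (of_int a :: 'p padic) = 1" by (rule padic_norm_of_int_eq_1)
    obtain c where "b = ?p * c" using pb by (auto elim: dvdE)
    then have "padic_norm (of_int b :: 'p padic) = padic_norm (of_int c :: 'p padic) / real CARD('p)"
      by (simp add: padic_norm_mult padic_norm_p)
    also have "\<dots> < 1" using padic_norm_of_int_le_1[of c, where ?'p='p] p1 by simp
    finally have lt: "padic_norm (of_int b :: 'p padic) < 1" .
    have "padic_norm (of_int b :: 'p padic) > 0"
      using b padic_norm_nonneg[of "of_int b :: 'p padic"]
      by (simp add: less_le padic_norm_eq_0_iff padic_of_int_eq_0_iff)
    then show False using q1 a1 lt by (simp add: padic_norm_divide divide_le_eq)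
  qed
  then have b1: "padic_norm (of_int b :: 'p padic) = 1" by (rule padic_norm_of_int_eq_1)
  have "coprime ?p b"
    using \<open>\<not> ?p dvd b\<close> prime_card[where ?'a='p] by (simp add: prime_imp_coprime)
  then obtain u v where uv: "u * ?p + v * b = 1"
    by (metis coprime_iff_gcd_eq_1 bezout_int)
  define d where "d = (a * v) mod ?p"
  have d: "0 \<le> d" "d < ?p" using p1 by (auto simp: d_def)
  have "?p dvd a - d * b"
  proof -
    have "a - d * b = a * (u * ?p + v * b) - d * b" by (simp add: uv)
    also have "\<dots> = ?p * (a * u + (a * v) div ?p * b)"
    proof -
      have "a * v = ?p * ((a * v) div ?p) + d" by (simp add: d_def)
      then show ?thesis by algebra
    qed
    finally show ?thesis by simp
  qed
  then obtain c where c: "a - d * b = ?p * c" by (auto elim: dvdE)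
  have b0: "of_int b \<noteq> (0 :: 'p padic)" using b1 by auto
  have "of_int a / of_int b - of_int d = (uniformizer * of_int c / of_int b :: 'p padic)"
    using arg_cong[OF c, of "of_int :: int \<Rightarrow> 'p padic"] b0 by (simp add: field_simps)
  then have "padic_norm (of_int a / of_int b - of_int d :: 'p padic) \<le> 1 / real CARD('p)"
    using padic_norm_of_int_le_1[of c, where ?'p='p] p1
    by (simp add: padic_norm_divide padic_norm_mult padic_norm_p b1 divide_right_mono)
  from padic_norm_add_le[OF less_imp_le[OF q] this]
  have "padic_norm (x - of_int d) \<le> 1 / real CARD('p)" by simp
  then have "padic_norm ((x - of_int d) / uniformizer) \<le> 1"
    using p1 by (simp add: padic_norm_divide padic_norm_p field_simps)
  then show ?thesis using that[of "nat d"] d by (simp add: nat_less_iff)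
qed

section \<open>Digit expansions, the additive character and the shifts\<close>

text \<open>
  The expansion is produced greedily: multiply by a power of \<open>p\<close> to land in the unit ball, then
  repeatedly subtract a residue digit and divide by \<open>p\<close>. The remainders after \<open>n\<close>
  steps have norm at most \<open>p\<^sup>g\<^sup>-\<^sup>n\<close>, which gives convergence.
\<close>

lemma padic_expansion_exists:
  fixes x :: "'p::prime_card padic"
  obtains a :: "nat \<Rightarrow> nat" and g :: nat where "\<And>k. a k < CARD('p)"
    "\<And>n. padic_norm (x - (\<Sum>k<n. of_nat (a k) * uniformizer powi (int k - int g)))
        \<le> real CARD('p) powi (int g - int n)"
proof -
  obtain g where "padic_norm x < real CARD('p) ^ g"
    using real_arch_pow[OF prime_card_gt_1] by blast
  then have g: "padic_norm x \<le> real CARD('p) powi (int g)" by simp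
  define digit where "digit = (\<lambda>y :: 'p padic.
      SOME d. d < CARD('p) \<and> padic_norm ((y - of_nat d) / uniformizer) \<le> 1)"
  have digit: "digit y < CARD('p) \<and> padic_norm ((y - of_nat (digit y)) / uniformizer) \<le> 1"
    if "padic_norm y \<le> 1" for y
    unfolding digit_def by (rule someI_ex) (use residue_digit[OF that] in metis)
  define y where "y n = ((\<lambda>y. (y - of_nat (digit y)) / uniformizer) ^^ n) (uniformizer powi (int g) * x)" for n
  have y_le: "padic_norm (y n) \<le> 1" for n
  proof (induction n)
    case 0
    show ?case using padic_norm_scaled_le_iff[of "int g" x "int g"] g by (simp add: y_def)
  next
    case (Suc n)
    then show ?case using digit[of "y n"] by (simp add: y_def)
  qed
  have y_Suc: "y n = of_nat (digit (y n)) + uniformizer * y (Suc n)" for n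
    by (simp add: y_def)
  have remainder: "x - (\<Sum>k<n. of_nat (digit (y k)) * uniformizer powi (int k - int g))
      = uniformizer powi (int n - int g) * y n" for n
  proof (induction n)
    case 0
    then show ?case by (simp add: y_def power_int_minus)
  next
    case (Suc n)
    have "uniformizer powi (int (Suc n) - int g) = uniformizer powi (int n - int g) * (uniformizer :: 'p padic)"
      using power_int_add_1[of "uniformizer :: 'p padic" "int n - int g"]
      by (simp add: algebra_simps)
    then have "uniformizer powi (int n - int g) * y n
        = of_nat (digit (y n)) * uniformizer powi (int n - int g)
          + uniformizer powi (int (Suc n) - int g) * y (Suc n)"
      by (subst y_Suc) (simp only: algebra_simps)
    with Suc show ?case by (simp add: algebra_simps)
  qed
  show ?thesis
  proof (rule that[of "\<lambda>k. digit (y k)" g])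
    show "digit (y k) < CARD('p)" for k using digit[OF y_le[of k]] by simp
    show "padic_norm (x - (\<Sum>k<n. of_nat (digit (y k)) * uniformizer powi (int k - int g)))
        \<le> real CARD('p) powi (int g - int n)" for n
      unfolding remainder
      using padic_norm_scaled_le_iff[of "int n - int g" "y n" 0] y_le[of n] by simp
  qed
qed

lemma expansion_partial_sum:
  "(\<Sum>k<n. of_nat (a k) * uniformizer powi (int k - int g))
     = (of_nat (\<Sum>k<n. a k * CARD('p) ^ k) / uniformizer ^ g :: 'p::prime_card padic)"
proof -
  have "uniformizer powi (int k - int g) = (uniformizer ^ k / uniformizer ^ g :: 'p padic)" for k
    by (simp add: power_int_diff)
  then show ?thesis by (simp add: sum_divide_distrib)
qed

lemma digit_sum_less:
  fixes a :: "nat \<Rightarrow> nat"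
  assumes "\<And>k. a k < b"
  shows "(\<Sum>k<n. a k * b ^ k) < b ^ n"
proof (induction n)
  case (Suc n)
  have "a n * b ^ n + b ^ n \<le> b * b ^ n"
    using mult_le_mono1[of "Suc (a n)" b "b ^ n"] assms[of n] by simp
  with Suc show ?case by simp
qed simp

lemma digit_sum_exists:
  fixes b k :: nat
  assumes "0 < b" "k < b ^ n"
  obtains a :: "nat \<Rightarrow> nat" where "\<And>j. a j < b" "(\<Sum>j<n. a j * b ^ j) = k"
proof (rule that)
  show "k div b ^ j mod b < b" for j using assms by simp
  have "(\<Sum>j<m. (k div b ^ j mod b) * b ^ j) = k mod b ^ m" for m
  proof (induction m)
    case (Suc m)
    then show ?case using mod_mult2_eq[of k "b ^ m" b] by (simp add: mult.commute)
  qed simp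
  then show "(\<Sum>j<n. (k div b ^ j mod b) * b ^ j) = k" using assms by simp
qed

lemma padic_norm_sum_le:
  assumes "\<And>i. i \<in> I \<Longrightarrow> padic_norm (f i :: 'p::prime_card padic) \<le> r" "0 \<le> r"
  shows "padic_norm (\<Sum>i\<in>I. f i) \<le> r"
  using assms by (induction I rule: infinite_finite_induct) (auto intro: padic_norm_add_le)

text \<open>
  A rational number with p-power denominator that is a p-adic integer is an ordinary integer. This
  is what makes the fractional part well defined modulo \<open>1\<close>.
\<close>

lemma fractions_congruent:
  assumes "padic_norm (of_int k / uniformizer ^ n - of_int l / uniformizer ^ m :: 'p::prime_card padic) \<le> 1"
  obtains i :: int where "real_of_int k / real CARD('p) ^ n = real_of_int l / real CARD('p) ^ m + of_int i"
proof -
  let ?p = "int CARD('p)"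
  have p: "real CARD('p) > 1" by (rule prime_card_gt_1)
  have "of_int k / uniformizer ^ n - of_int l / uniformizer ^ m
      = (of_int (k * ?p ^ m - l * ?p ^ n) / uniformizer ^ (n + m) :: 'p padic)"
    by (simp add: field_simps power_add)
  also have "\<dots> = uniformizer powi (- int (n + m)) * of_int (k * ?p ^ m - l * ?p ^ n)"
    by (simp only: power_int_minus power_int_of_nat divide_inverse mult.commute)
  finally have "padic_norm (of_int (k * ?p ^ m - l * ?p ^ n) :: 'p padic)
      \<le> real CARD('p) powi (- int (n + m))"
    using assms padic_norm_scaled_le_iff[of "- int (n + m)" _ "- int (n + m)", where ?'p='p]
    by (metis diff_self power_int_0_right)
  then have "?p ^ (n + m) dvd k * ?p ^ m - l * ?p ^ n" by (rule power_dvd_if_padic_norm_le)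
  then obtain i where "k * ?p ^ m - l * ?p ^ n = ?p ^ (n + m) * i" by (auto elim: dvdE)
  from arg_cong[OF this, of real_of_int]
  have "real_of_int k * real CARD('p) ^ m - of_int l * real CARD('p) ^ n = real CARD('p) ^ (n + m) * of_int i"
    by simp
  then have "real_of_int k / real CARD('p) ^ n = real_of_int l / real CARD('p) ^ m + of_int i"
    using p by (simp add: field_simps power_add)
  then show ?thesis by (rule that)
qed

text \<open>
  The terms of nonnegative exponent contribute only an element of the unit ball.
\<close>

lemma expansion_fraction:
  fixes x :: "'p::prime_card padic"
  assumes a: "\<And>k. a k < CARD('p)"
    and x: "(\<lambda>k. of_nat (a k) * uniformizer powi (int k - int g)) sums x"
  shows "padic_norm (x - of_nat (\<Sum>k<g. a k * CARD('p) ^ k) / uniformizer ^ g) \<le> 1"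
proof -
  let ?s = "\<lambda>n. \<Sum>k<n. of_nat (a k) * uniformizer powi (int k - int g) :: 'p padic"
  have "\<forall>\<^sub>F n in sequentially. dist (?s n) x < 1"
    using x unfolding sums_def by (rule tendstoD) simp
  then have "\<forall>\<^sub>F n in sequentially. n \<ge> g \<and> dist (?s n) x < 1"
    using eventually_ge_at_top by (rule eventually_conj[rotated])
  then obtain n where n: "n \<ge> g" "dist (?s n) x < 1"
    using eventually_happens' [OF sequentially_bot] by blast
  have "?s n - ?s g = (\<Sum>k\<in>{g..<n}. of_nat (a k) * uniformizer powi (int k - int g))"
    unfolding lessThan_atLeast0 using n(1) by (intro sum_diff_nat_ivl) auto
  also have "padic_norm \<dots> \<le> 1"
  proof (rule padic_norm_sum_le)
    fix k assume "k \<in> {g..<n}"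
    then have "uniformizer powi (int k - int g) = (of_int (int CARD('p) ^ (k - g)) :: 'p padic)"
      by (simp add: power_int_def nat_diff_distrib)
    then have "of_nat (a k) * uniformizer powi (int k - int g)
        = (of_int (int (a k) * int CARD('p) ^ (k - g)) :: 'p padic)" by simp
    then show "padic_norm (of_nat (a k) * uniformizer powi (int k - int g) :: 'p padic) \<le> 1"
      by (simp only: padic_norm_of_int_le_1)
  qed simp
  finally have "padic_norm (?s n - ?s g) \<le> 1" .
  moreover have "padic_norm (x - ?s n) \<le> 1"
    using n by (simp add: dist_padic_def padic_norm_diff_commute[of x])
  ultimately have "padic_norm ((x - ?s n) + (?s n - ?s g)) \<le> 1" by (intro padic_norm_add_le)
  then show ?thesis by (simp add: expansion_partial_sum)
qed

text \<open>
  The definite description in the definition of the fractional part is discharged here: an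
  expansion exists, and two candidate values are fractions in \<open>[0, 1)\<close> that differ by an integer.
\<close>

lemma frac_part_fraction:
  fixes x :: "'p::prime_card padic"
  obtains k n :: nat where "frac_part x = real k / real CARD('p) ^ n"
    "padic_norm (x - of_nat k / uniformizer ^ n) \<le> 1"
proof -
  have p: "real CARD('p) > 1" by (rule prime_card_gt_1)
  define E where "E r \<longleftrightarrow> (\<exists>(g :: nat) (a :: nat \<Rightarrow> nat). (\<forall>k. a k < CARD('p)) \<and>
      (\<lambda>k. of_nat (a k) * uniformizer powi (int k - int g)) sums x \<and>
      r = (\<Sum>k<g. real (a k) * real CARD('p) powi (int k - int g)))" for r
  have fraction: "\<exists>k n. k < CARD('p) ^ n \<and> r = real k / real CARD('p) ^ n
      \<and> padic_norm (x - of_nat k / uniformizer ^ n) \<le> 1" if Er: "E r" for r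
  proof -
    obtain g a where a: "\<forall>k. a k < CARD('p)"
      and s: "(\<lambda>k. of_nat (a k) * uniformizer powi (int k - int g)) sums x"
      and r: "r = (\<Sum>k<g. real (a k) * real CARD('p) powi (int k - int g))"
      using Er unfolding E_def by blast
    have "r = real (\<Sum>k<g. a k * CARD('p) ^ k) / real CARD('p) ^ g"
      using p by (simp add: r power_int_diff sum_divide_distrib)
    moreover have "(\<Sum>k<g. a k * CARD('p) ^ k) < CARD('p) ^ g"
      by (rule digit_sum_less) (use a in simp)
    moreover have "padic_norm (x - of_nat (\<Sum>k<g. a k * CARD('p) ^ k) / uniformizer ^ g) \<le> 1"
      by (rule expansion_fraction[OF _ s]) (use a in simp)
    ultimately show ?thesis by (intro exI conjI)
  qed
  have ex: "\<exists>r. E r"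
  proof -
    obtain a :: "nat \<Rightarrow> nat" and g :: nat where a: "\<And>k. a k < CARD('p)"
      and n: "\<And>n. padic_norm (x - (\<Sum>k<n. of_nat (a k) * uniformizer powi (int k - int g)))
        \<le> real CARD('p) powi (int g - int n)"
      by (rule padic_expansion_exists[of x]) (rule that)
    have lim: "(\<lambda>n. real CARD('p) ^ g * (1 / real CARD('p)) ^ n) \<longlonglongrightarrow> 0"
      using p by (intro tendsto_mult_right_zero LIMSEQ_realpow_zero) auto
    have "(\<lambda>k. of_nat (a k) * uniformizer powi (int k - int g)) sums x"
      unfolding sums_def
    proof (rule tendstoI)
      fix e :: real assume "e > 0"
      from order_tendstoD(2)[OF lim this]
      show "\<forall>\<^sub>F m in sequentially. dist (\<Sum>k<m. of_nat (a k) * uniformizer powi (int k - int g)) x < e"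
      proof eventually_elim
        case (elim m)
        have "real CARD('p) powi (int g - int m) = real CARD('p) ^ g * (1 / real CARD('p)) ^ m"
          using p by (simp add: power_int_diff power_one_over)
        with n[of m] elim show ?case
          by (simp add: dist_padic_def padic_norm_diff_commute[of _ x])
      qed
    qed
    with a show ?thesis unfolding E_def by blast
  qed
  have uniq: "r = r'" if "E r" "E r'" for r r'
  proof -
    obtain k n where k: "k < CARD('p) ^ n" "r = real k / real CARD('p) ^ n"
      "padic_norm (x - of_nat k / uniformizer ^ n) \<le> 1" using fraction[OF \<open>E r\<close>] by blast
    obtain l m where l: "l < CARD('p) ^ m" "r' = real l / real CARD('p) ^ m"
      "padic_norm (x - of_nat l / uniformizer ^ m) \<le> 1" using fraction[OF \<open>E r'\<close>] by blast
    have "padic_norm (of_int (int k) / uniformizer ^ n - of_int (int l) / uniformizer ^ m :: 'p padic) \<le> 1"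
      using padic_norm_diff_le[OF l(3) k(3)] by simp
    then obtain i where "real_of_int (int k) / real CARD('p) ^ n
        = real_of_int (int l) / real CARD('p) ^ m + of_int i"
      by (rule fractions_congruent)
    then have i: "r = r' + of_int i" using k l by simp
    have "real k < real CARD('p) ^ n" "real l < real CARD('p) ^ m"
      using k(1) l(1) by (metis of_nat_less_iff of_nat_power)+
    then have "0 \<le> r" "r < 1" "0 \<le> r'" "r' < 1"
      using p k(2) l(2) by (auto simp: divide_less_eq)
    with i have "-1 < real_of_int i" "real_of_int i < 1" by linarith+
    then have "i = 0" by linarith
    with i show ?thesis by simp
  qed
  have "frac_part x = (THE r. E r)" unfolding frac_part_def E_def ..
  then have "E (frac_part x)" using theI'[of E] ex uniq by metis
  then show ?thesis using fraction that by blast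
qed

text \<open>
  The working description of the character: the value may be read off from any approximation of
  \<open>x\<close> by a p-power fraction up to a p-adic integer, not only from the canonical expansion.
\<close>

lemma padic_char_fraction:
  fixes x :: "'p::prime_card padic"
  assumes "padic_norm (x - of_int k / uniformizer ^ n) \<le> 1"
  shows "padic_char x = cis (2 * pi * (real_of_int k / real CARD('p) ^ n))"
proof -
  obtain l m where l: "frac_part x = real l / real CARD('p) ^ m"
    "padic_norm (x - of_nat l / uniformizer ^ m) \<le> 1" by (rule frac_part_fraction)
  have "padic_norm (of_int (int l) / uniformizer ^ m - of_int k / uniformizer ^ n :: 'p padic) \<le> 1"
    using padic_norm_diff_le[OF assms l(2)] by simp
  then obtain i where "real_of_int (int l) / real CARD('p) ^ m
      = real_of_int k / real CARD('p) ^ n + of_int i" by (rule fractions_congruent)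
  then have "frac_part x = real_of_int k / real CARD('p) ^ n + of_int i" using l by simp
  then have "padic_char x = cis (2 * pi * (real_of_int k / real CARD('p) ^ n) + 2 * pi * of_int i)"
    by (simp add: padic_char_def cis_conv_exp algebra_simps)
  also have "\<dots> = cis (2 * pi * (real_of_int k / real CARD('p) ^ n)) * cis (2 * pi * of_int i)"
    by (simp only: cis_mult)
  finally show ?thesis by (simp add: cis_multiple_2pi)
qed

lemma fraction_dense:
  fixes x :: "'p::prime_card padic"
  obtains k n :: nat where "padic_norm (x - of_nat k / uniformizer ^ n) \<le> real CARD('p) powi \<gamma>"
proof -
  obtain a :: "nat \<Rightarrow> nat" and g :: nat where "\<And>k. a k < CARD('p)"
    and n: "\<And>n. padic_norm (x - (\<Sum>k<n. of_nat (a k) * uniformizer powi (int k - int g)))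
        \<le> real CARD('p) powi (int g - int n)"
    by (rule padic_expansion_exists[of x]) (rule that)
  have "real CARD('p) powi (int g - int (nat (int g - \<gamma>))) \<le> real CARD('p) powi \<gamma>"
    using prime_card_gt_1[where ?'p='p] by (intro power_int_increasing) auto
  with n[of "nat (int g - \<gamma>)"] show ?thesis
    unfolding expansion_partial_sum by (intro that) (rule order.trans)
qed

lemma padic_char_add:
  fixes x y :: "'p::prime_card padic"
  shows "padic_char (x + y) = padic_char x * padic_char y"
proof -
  have p: "real CARD('p) > 1" by (rule prime_card_gt_1)
  obtain k n :: nat where k: "padic_norm (x - of_nat k / uniformizer ^ n) \<le> 1"
    using fraction_dense[of x 0] by auto
  obtain l m :: nat where l: "padic_norm (y - of_nat l / uniformizer ^ m) \<le> 1"
    using fraction_dense[of y 0] by auto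
  have "of_nat k / uniformizer ^ n + of_nat l / uniformizer ^ m
      = (of_int (int (k * CARD('p) ^ m + l * CARD('p) ^ n)) / uniformizer ^ (n + m) :: 'p padic)"
    by (simp add: field_simps power_add)
  with padic_norm_add_le[OF k l]
  have "padic_norm (x + y - of_int (int (k * CARD('p) ^ m + l * CARD('p) ^ n)) / uniformizer ^ (n + m)) \<le> 1"
    by (simp add: algebra_simps)
  then have "padic_char (x + y) = cis (2 * pi *
      (real_of_int (int (k * CARD('p) ^ m + l * CARD('p) ^ n)) / real CARD('p) ^ (n + m)))"
    by (rule padic_char_fraction)
  also have "\<dots> = cis (2 * pi * (real k / real CARD('p) ^ n) + 2 * pi * (real l / real CARD('p) ^ m))"
    using p by (intro arg_cong[of _ _ cis]) (simp add: field_simps power_add)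
  also have "\<dots> = padic_char x * padic_char y"
    using padic_char_fraction[of x "int k" n] padic_char_fraction[of y "int l" m] k l
    by (simp add: cis_mult)
  finally show ?thesis .
qed

lemma padic_char_eq_1_iff:
  fixes x :: "'p::prime_card padic"
  shows "padic_char x = 1 \<longleftrightarrow> padic_norm x \<le> 1"
proof
  assume "padic_norm x \<le> 1"
  then show "padic_char x = 1" using padic_char_fraction[of x 0 0] by simp
next
  assume x: "padic_char x = 1"
  obtain k n :: nat where k: "padic_norm (x - of_nat k / uniformizer ^ n) \<le> 1"
    using fraction_dense[of x 0] by auto
  then have "cis (2 * pi * (real k / real CARD('p) ^ n)) = 1"
    using padic_char_fraction[of x "int k" n] x by simp
  then have "cos (2 * pi * (real k / real CARD('p) ^ n)) = 1" by (simp add: complex_eq_iff)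
  then obtain i :: int where "2 * pi * (real k / real CARD('p) ^ n) = of_int i * 2 * pi"
    unfolding cos_one_2pi_int by blast
  then have "2 * pi * (real k / real CARD('p) ^ n) = 2 * pi * of_int i" by simp
  then have i: "real k / real CARD('p) ^ n = of_int i"
    unfolding mult_cancel_left by simp
  have p: "real CARD('p) > 1" by (rule prime_card_gt_1)
  have "real k = of_int (i * int CARD('p) ^ n)" using i p by (simp add: field_simps)
  then have "int k = i * int CARD('p) ^ n" by linarith
  then have "of_nat k / uniformizer ^ n = (of_int i :: 'p padic)"
    by (metis (mono_tags, opaque_lifting) nonzero_mult_div_cancel_right of_int_mult of_int_of_nat_eq of_int_power power_not_zero uniformizer_nonzero)
  with k padic_norm_add_le[of "x - of_int i" 1 "of_int i"] padic_norm_of_int_le_1[of i, where ?'p='p]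
  show "padic_norm x \<le> 1" by simp
qed

lemma shift_set_eq: "(shift_set :: 'p::prime_card padic set)
    = {of_nat k / uniformizer ^ n | k n. k < CARD('p) ^ n}"
proof -
  have eq: "uniformizer powi (- int n) * (\<Sum>j<n. of_nat (a j) * uniformizer ^ j)
      = (of_nat (\<Sum>j<n. a j * CARD('p) ^ j) / uniformizer ^ n :: 'p padic)" for a n
    by (simp add: power_int_minus divide_inverse mult.commute)
  show ?thesis
    unfolding shift_set_def eq
  proof (intro equalityI subsetI)
    fix x :: "'p padic"
    assume "x \<in> {of_nat (\<Sum>j<n. a j * CARD('p) ^ j) / uniformizer ^ n | n a. \<forall>j. a j < CARD('p)}"
    then obtain n and a :: "nat \<Rightarrow> nat" where "\<forall>j. a j < CARD('p)"
      and x: "x = of_nat (\<Sum>j<n. a j * CARD('p) ^ j) / uniformizer ^ n" by blast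
    then have "(\<Sum>j<n. a j * CARD('p) ^ j) < CARD('p) ^ n" by (intro digit_sum_less) simp
    with x show "x \<in> {of_nat k / uniformizer ^ n | k n. k < CARD('p) ^ n}" by blast
  next
    fix x :: "'p padic"
    assume "x \<in> {of_nat k / uniformizer ^ n | k n. k < CARD('p) ^ n}"
    then obtain k n where x: "x = of_nat k / uniformizer ^ n" and k: "k < CARD('p) ^ n" by blast
    have "0 < CARD('p)" by simp
    then obtain a where "\<forall>j. a j < CARD('p)" "(\<Sum>j<n. a j * CARD('p) ^ j) = k"
      using digit_sum_exists[OF _ k] by metis
    with x show "x \<in> {of_nat (\<Sum>j<n. a j * CARD('p) ^ j) / uniformizer ^ n | n a. \<forall>j. a j < CARD('p)}"
      by blast
  qed
qed

text \<open>
  At each level the shifts are exactly the multiples \<open>0, 1, \<dots>, p\<^sup>n - 1\<close> of \<open>p\<^sup>-\<^sup>n\<close>. They form an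
  arithmetic progression although the set of all shifts is not a group.
\<close>

lemma shift_set_Int_ball:
  "shift_set \<inter> padic_ball (int n) 0
    = (\<lambda>k. of_nat k / uniformizer ^ n :: 'p::prime_card padic) ` {..<CARD('p) ^ n}"
proof (intro equalityI subsetI)
  fix a :: "'p padic" assume "a \<in> (\<lambda>k. of_nat k / uniformizer ^ n) ` {..<CARD('p) ^ n}"
  then obtain k where k: "k < CARD('p) ^ n" "a = of_nat k / uniformizer ^ n" by blast
  have "padic_norm (uniformizer powi (- int n) * of_int (int k) :: 'p padic) \<le> real CARD('p) powi (0 - - int n)"
    unfolding padic_norm_scaled_le_iff using padic_norm_of_int_le_1[of "int k"] by simp
  with k show "a \<in> shift_set \<inter> padic_ball (int n) 0"
    by (auto simp: shift_set_eq padic_ball_def power_int_minus divide_inverse mult.commute)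
next
  fix a :: "'p padic" assume a: "a \<in> shift_set \<inter> padic_ball (int n) 0"
  then obtain k m where k: "k < CARD('p) ^ m" "a = of_nat k / uniformizer ^ m"
    and le: "padic_norm a \<le> real CARD('p) powi int n"
    by (auto simp: shift_set_eq padic_ball_def)
  show "a \<in> (\<lambda>k. of_nat k / uniformizer ^ n) ` {..<CARD('p) ^ n}"
  proof (cases "m \<le> n")
    case True
    have "k * CARD('p) ^ (n - m) < CARD('p) ^ m * CARD('p) ^ (n - m)" using k by simp
    also have "\<dots> = CARD('p) ^ n" using True by (simp flip: power_add)
    finally have "k * CARD('p) ^ (n - m) < CARD('p) ^ n" .
    moreover have "a = of_nat (k * CARD('p) ^ (n - m)) / uniformizer ^ n"
      using True by (simp add: k field_simps flip: power_add)
    ultimately show ?thesis by blast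
  next
    case False
    have "a = uniformizer powi (- int m) * of_int (int k)"
      by (simp add: k power_int_minus divide_inverse mult.commute)
    then have "padic_norm (of_int (int k) :: 'p padic) \<le> real CARD('p) powi (- int (m - n))"
      using le padic_norm_scaled_le_iff[of "- int m" "of_int (int k) :: 'p padic" "- int (m - n)"] False
      by (simp add: of_nat_diff)
    then have "int CARD('p) ^ (m - n) dvd int k" by (rule power_dvd_if_padic_norm_le)
    then have "CARD('p) ^ (m - n) dvd k" by (metis of_nat_dvd_iff of_nat_power)
    then obtain l where l: "k = CARD('p) ^ (m - n) * l" by (auto elim: dvdE)
    have m: "m = (m - n) + n" using False by simp
    have "CARD('p) ^ (m - n) * l < CARD('p) ^ (m - n) * CARD('p) ^ n"
      using k(1) l by (metis m power_add)
    then have "l < CARD('p) ^ n" by simp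
    moreover have "a = of_nat l / uniformizer ^ n"
      unfolding k(2) l by (subst m, subst power_add) simp
    ultimately show ?thesis by blast
  qed
qed

lemma inj_on_fractions: "inj_on (\<lambda>k. of_nat k / uniformizer ^ n :: 'p::prime_card padic) A"
proof (rule inj_onI)
  fix k l :: nat assume "of_nat k / uniformizer ^ n = (of_nat l / uniformizer ^ n :: 'p padic)"
  then have "of_int (int k - int l) = (0 :: 'p padic)" by simp
  then show "k = l" unfolding padic_of_int_eq_0_iff by simp
qed

lemma zero_in_shift_set: "(0 :: 'p::prime_card padic) \<in> shift_set"
  unfolding shift_set_eq by (intro CollectI exI[of _ 0]) simp

section \<open>Ultrametric balls and the Borel sets\<close>

lemma padic_ball_eq_cball: "padic_ball \<gamma> (a :: 'p::prime_card padic) = cball a (real CARD('p) powi \<gamma>)"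
  by (auto simp: padic_ball_def dist_padic_def padic_norm_diff_commute)

lemma closed_padic_ball: "closed (padic_ball \<gamma> (a :: 'p::prime_card padic))"
  by (simp add: padic_ball_eq_cball)

lemma padic_ball_add_iff:
  fixes x y :: "'p::prime_card padic"
  assumes "y \<in> padic_ball \<gamma> 0"
  shows "x + y \<in> padic_ball \<gamma> a \<longleftrightarrow> x \<in> padic_ball \<gamma> a"
proof -
  have y: "padic_norm y \<le> real CARD('p) powi \<gamma>" using assms by (simp add: padic_ball_def)
  show ?thesis
    using padic_norm_add_le[OF _ y, of "x - a"] padic_norm_diff_le[OF _ y, of "x + y - a"]
    by (auto simp: padic_ball_def algebra_simps)
qed

lemma padic_ball_diff_iff:
  fixes x y :: "'p::prime_card padic"
  assumes "y \<in> padic_ball \<gamma> 0"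
  shows "x - y \<in> padic_ball \<gamma> a \<longleftrightarrow> x \<in> padic_ball \<gamma> a"
  using padic_ball_add_iff[OF assms, of "x - y" a] by simp

lemma padic_ball_mono:
  assumes "\<gamma> \<le> \<delta>"
  shows "padic_ball \<gamma> a \<subseteq> padic_ball \<delta> (a :: 'p::prime_card padic)"
  using power_int_increasing[OF assms, of "real CARD('p)"] prime_card_gt_1[where ?'p='p]
  by (auto simp: padic_ball_def)

text \<open>
  Every point of an ultrametric ball is a centre of it.
\<close>

lemma padic_ball_recenter:
  fixes x :: "'p::prime_card padic"
  assumes "x \<in> padic_ball \<gamma> a"
  shows "padic_ball \<gamma> x = padic_ball \<gamma> a"
proof -
  have "x - a \<in> padic_ball \<gamma> 0" using assms by (simp add: padic_ball_def)
  then have "y + (x - a) \<in> padic_ball \<gamma> x \<longleftrightarrow> y \<in> padic_ball \<gamma> x" for y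
    by (rule padic_ball_add_iff)
  then show ?thesis by (auto simp: padic_ball_def algebra_simps)
qed

lemma open_padic_ball: "open (padic_ball \<gamma> (a :: 'p::prime_card padic))"
  unfolding open_dist
proof (intro ballI exI conjI allI impI)
  fix x y assume x: "x \<in> padic_ball \<gamma> a" and d: "dist y x < real CARD('p) powi \<gamma>"
  from d have "y \<in> padic_ball \<gamma> x" by (simp add: padic_ball_def dist_padic_def)
  with x show "y \<in> padic_ball \<gamma> a" by (simp add: padic_ball_recenter)
next
  show "0 < real CARD('p) powi \<gamma>" using prime_card_gt_1[where ?'p='p] by simp
qed

text \<open>
  The \<open>p\<close> pieces correspond to the residue digit of \<open>p\<^sup>\<gamma>\<^sup>+\<^sup>1 x\<close>.
\<close>

lemma padic_ball_partition:
  "padic_ball (\<gamma> + 1) (0 :: 'p::prime_card padic)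
     = (\<Union>d<CARD('p). padic_ball \<gamma> (uniformizer powi (- \<gamma> - 1) * of_nat d))"
  (is "_ = (\<Union>d<_. padic_ball \<gamma> (?c d))")
proof (intro equalityI subsetI)
  fix x :: "'p padic" assume "x \<in> padic_ball (\<gamma> + 1) 0"
  then have "padic_norm (uniformizer powi (\<gamma> + 1) * x) \<le> 1"
    using padic_norm_scaled_le_iff[of "\<gamma> + 1" x "\<gamma> + 1"] by (simp add: padic_ball_def)
  then obtain d where d: "d < CARD('p)"
    "padic_norm ((uniformizer powi (\<gamma> + 1) * x - of_nat d) / uniformizer) \<le> 1"
    by (rule residue_digit)
  have "(uniformizer powi (\<gamma> + 1) * x - of_nat d) / uniformizer = uniformizer powi \<gamma> * (x - ?c d)"
    by (simp add: power_int_add power_int_diff power_int_minus field_simps)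
  with d(2) have "x \<in> padic_ball \<gamma> (?c d)"
    using padic_norm_scaled_le_iff[of \<gamma> "x - ?c d" \<gamma>] by (simp add: padic_ball_def)
  with d(1) show "x \<in> (\<Union>d<CARD('p). padic_ball \<gamma> (?c d))" by blast
next
  fix x :: "'p padic" assume "x \<in> (\<Union>d<CARD('p). padic_ball \<gamma> (?c d))"
  then obtain d where "x \<in> padic_ball \<gamma> (?c d)" by blast
  then have "x \<in> padic_ball (\<gamma> + 1) (?c d)" using padic_ball_mono[of \<gamma> "\<gamma> + 1"] by auto
  moreover have "padic_norm (uniformizer powi (- \<gamma> - 1) * of_int (int d) :: 'p padic)
      \<le> real CARD('p) powi (0 - (- \<gamma> - 1))"
    unfolding padic_norm_scaled_le_iff using padic_norm_of_int_le_1[of "int d"] by simp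
  then have "0 \<in> padic_ball (\<gamma> + 1) (?c d)"
    by (simp add: padic_ball_def padic_norm_minus add.commute)
  ultimately show "x \<in> padic_ball (\<gamma> + 1) 0" using padic_ball_recenter by blast
qed

text \<open>
  The empty set is included so that the family is closed under intersection: two balls are
  nested or disjoint. Being also a countable basis, it generates the Borel sets, so it
  determines Borel measures that are finite on balls.
\<close>

definition empty_or_ball :: "'p::prime_card padic set set" where
  "empty_or_ball = insert {} (range (\<lambda>(\<gamma>, a). padic_ball \<gamma> a))"

lemma Int_stable_empty_or_ball: "Int_stable (empty_or_ball :: 'p::prime_card padic set set)"
proof (rule Int_stableI)
  fix A B :: "'p padic set" assume AB: "A \<in> empty_or_ball" "B \<in> empty_or_ball"
  show "A \<inter> B \<in> empty_or_ball"
  proof (cases "A \<inter> B = {}")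
    case False
    then obtain x where x: "x \<in> A" "x \<in> B" by blast
    have "\<exists>\<gamma>. C = padic_ball \<gamma> x" if "C \<in> empty_or_ball" "x \<in> C" for C
      using that padic_ball_recenter by (force simp: empty_or_ball_def)
    with AB x obtain \<gamma> \<delta> where "A = padic_ball \<gamma> x" "B = padic_ball \<delta> x"
      by metis
    then have "A \<inter> B = A \<or> A \<inter> B = B"
      using padic_ball_mono[of \<gamma> \<delta> x] padic_ball_mono[of \<delta> \<gamma> x] by fastforce
    with AB show ?thesis by auto
  qed (simp add: empty_or_ball_def)
qed

text \<open>
  A ball can be recentred at a p-power fraction, so countably many centres suffice.
\<close>

lemma countable_empty_or_ball: "countable (empty_or_ball :: 'p::prime_card padic set set)"
proof (rule countable_subset)
  show "empty_or_ball \<subseteq> insert {} (range (\<lambda>(\<gamma>, k, n).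
      padic_ball \<gamma> (of_nat k / uniformizer ^ n :: 'p padic)))"
  proof
    fix A :: "'p padic set" assume "A \<in> empty_or_ball"
    moreover have "padic_ball \<gamma> a \<in> range (\<lambda>(\<gamma>, k, n). padic_ball \<gamma> (of_nat k / uniformizer ^ n))"
      for \<gamma> and a :: "'p padic"
    proof -
      obtain k n :: nat where "padic_norm (a - of_nat k / uniformizer ^ n) \<le> real CARD('p) powi \<gamma>"
        by (rule fraction_dense)
      then have "of_nat k / uniformizer ^ n \<in> padic_ball \<gamma> a"
        by (simp add: padic_ball_def padic_norm_diff_commute)
      then have "padic_ball \<gamma> a = padic_ball \<gamma> (of_nat k / uniformizer ^ n)"
        by (simp add: padic_ball_recenter)
      then show ?thesis by (intro image_eqI[of _ _ "(\<gamma>, k, n)"]) auto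
    qed
    ultimately show "A \<in> insert {} (range (\<lambda>(\<gamma>, k, n).
      padic_ball \<gamma> (of_nat k / uniformizer ^ n :: 'p padic)))"
      by (auto simp: empty_or_ball_def)
  qed
qed simp

lemma topological_basis_empty_or_ball:
  "topological_basis (empty_or_ball :: 'p::prime_card padic set set)"
proof (rule topological_basisI)
  show "open A" if "A \<in> empty_or_ball" for A :: "'p padic set"
    using that by (auto simp: empty_or_ball_def open_padic_ball)
next
  fix U and x :: "'p padic" assume "open U" "x \<in> U"
  then obtain e where e: "e > 0" "\<And>y. dist y x < e \<Longrightarrow> y \<in> U"
    unfolding open_dist by blast
  have p: "real CARD('p) > 1" by (rule prime_card_gt_1)
  then obtain n where n: "(1 / real CARD('p)) ^ n < e"
    using real_arch_pow_inv[OF e(1), of "1 / real CARD('p)"] by auto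
  have "padic_ball (- int n) x \<subseteq> U"
    using n by (auto simp: padic_ball_def dist_padic_def power_int_minus power_one_over
        inverse_eq_divide intro!: e(2))
  moreover have "x \<in> padic_ball (- int n) x" by (simp add: padic_ball_def)
  ultimately show "\<exists>B'\<in>empty_or_ball. x \<in> B' \<and> B' \<subseteq> U"
    by (auto simp: empty_or_ball_def)
qed

lemma sets_borel_padic: "sets borel = sigma_sets UNIV (empty_or_ball :: 'p::prime_card padic set set)"
  by (subst borel_eq_countable_basis[OF countable_empty_or_ball topological_basis_empty_or_ball])
    simp

lemma measurable_affine: "(\<lambda>x. c * x + a :: 'p::prime_card padic) \<in> borel_measurable borel"
proof (rule borel_measurable_continuous_onI)
  have le: "dist (c * y + a) (c * x + a) \<le> (padic_norm c + 1) * dist y x" for x y :: "'p padic"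
  proof -
    have "dist (c * y + a) (c * x + a) = padic_norm (c * (y - x))"
      by (simp add: dist_padic_def algebra_simps)
    then show ?thesis
      by (simp add: padic_norm_mult dist_padic_def distrib_right padic_norm_nonneg)
  qed
  have pos: "padic_norm c + 1 > 0" using padic_norm_nonneg[of c] by simp
  show "continuous_on UNIV (\<lambda>x. c * x + a)"
    unfolding continuous_on_iff
  proof (intro ballI allI impI)
    fix x :: "'p padic" and e :: real assume e: "0 < e"
    have "dist (c * y + a) (c * x + a) < e" if "dist y x < e / (padic_norm c + 1)" for y
    proof -
      have "(padic_norm c + 1) * dist y x < e" using that pos by (simp add: field_simps)
      then show ?thesis using le[of y x] by simp
    qed
    then show "\<exists>d>0. \<forall>x'\<in>UNIV. dist x' x < d \<longrightarrow> dist (c * x' + a) (c * x + a) < e"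
      using e pos by (intro exI[of _ "e / (padic_norm c + 1)"]) simp
  qed
qed

section \<open>Haar measure under translation and dilation\<close>

context
  fixes \<mu> :: "'p::prime_card padic measure"
  assumes haar: "normalized_haar \<mu>"
begin

lemma sets_haar [measurable_cong]: "sets \<mu> = sets borel"
  using haar by (simp add: normalized_haar_def)

lemma space_haar: "space \<mu> = UNIV"
  using sets_eq_imp_space_eq[OF sets_haar] by simp

lemma padic_ball_measurable [measurable]: "padic_ball \<gamma> a \<in> sets \<mu>"
  by (simp add: sets_haar open_padic_ball)

lemma translate_measurable: "(\<lambda>x. x + a) \<in> measurable \<mu> borel"
  using measurable_affine[of 1 a] by (simp add: measurable_cong_sets[OF sets_haar refl])

lemma distr_haar_translate: "distr \<mu> borel (\<lambda>x. x + a) = \<mu>"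
proof (rule measure_eqI)
  fix A assume "A \<in> sets (distr \<mu> borel (\<lambda>x. x + a))"
  then have A: "A \<in> sets borel" by simp
  then have "emeasure (distr \<mu> borel (\<lambda>x. x + a)) A = emeasure \<mu> ((\<lambda>x. x + a) -` A)"
    by (simp add: emeasure_distr[OF translate_measurable] space_haar)
  also have "(\<lambda>x. x + a) -` A = (+) (- a) ` A"
    by (auto simp: image_iff) (metis add.commute add_diff_cancel_right' diff_conv_add_uminus)
  also have "emeasure \<mu> \<dots> = emeasure \<mu> A"
    using haar A unfolding normalized_haar_def by blast
  finally show "emeasure (distr \<mu> borel (\<lambda>x. x + a)) A = emeasure \<mu> A" .
qed (simp add: sets_haar)

lemma integral_haar_translate:
  fixes f :: "'p padic \<Rightarrow> complex"
  assumes "f \<in> borel_measurable \<mu>"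
  shows "(\<integral>x. f (x + a) \<partial>\<mu>) = (\<integral>x. f x \<partial>\<mu>)"
proof -
  have "f \<in> borel_measurable borel" using assms by (simp add: measurable_cong_sets[OF sets_haar refl])
  from integral_distr[OF translate_measurable this, of a] show ?thesis
    by (simp add: distr_haar_translate)
qed

lemma AE_haar_translate:
  assumes "AE x in \<mu>. P x"
  shows "AE x in \<mu>. P (x + a)"
proof (rule AE_distrD[OF translate_measurable])
  show "AE x in distr \<mu> borel (\<lambda>x. x + a). P x"
    unfolding distr_haar_translate by (rule assms)
qed

lemma emeasure_padic_ball_center: "emeasure \<mu> (padic_ball \<gamma> a) = emeasure \<mu> (padic_ball \<gamma> 0)"
proof -
  have "padic_ball \<gamma> a = (+) a ` padic_ball \<gamma> 0"
  proof (intro equalityI subsetI)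
    fix x assume "x \<in> padic_ball \<gamma> a"
    then show "x \<in> (+) a ` padic_ball \<gamma> 0"
      by (intro image_eqI[of _ _ "x - a"]) (auto simp: padic_ball_def)
  qed (auto simp: padic_ball_def)
  then show ?thesis
    using haar padic_ball_measurable[of \<gamma> 0] by (simp add: normalized_haar_def)
qed

lemma emeasure_padic_ball_Suc:
  "emeasure \<mu> (padic_ball (\<gamma> + 1) 0) = ennreal (real CARD('p)) * emeasure \<mu> (padic_ball \<gamma> 0)"
proof -
  let ?c = "\<lambda>d. uniformizer powi (- \<gamma> - 1) * of_nat d :: 'p padic"
  have "disjoint_family_on (\<lambda>d. padic_ball \<gamma> (?c d)) {..<CARD('p)}"
    unfolding disjoint_family_on_def
  proof (intro ballI impI)
    fix d e assume de: "d \<in> {..<CARD('p)}" "e \<in> {..<CARD('p)}" "d \<noteq> e"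
    show "padic_ball \<gamma> (?c d) \<inter> padic_ball \<gamma> (?c e) = {}"
    proof (rule ccontr)
      assume "padic_ball \<gamma> (?c d) \<inter> padic_ball \<gamma> (?c e) \<noteq> {}"
      then have "padic_ball \<gamma> (?c d) = padic_ball \<gamma> (?c e)" using padic_ball_recenter by blast
      moreover have "?c d \<in> padic_ball \<gamma> (?c d)"
        using prime_card_gt_1[where ?'p='p] by (simp add: padic_ball_def)
      ultimately have "padic_norm (?c d - ?c e) \<le> real CARD('p) powi (- 1 - (- \<gamma> - 1))"
        by (simp add: padic_ball_def)
      moreover have "?c d - ?c e = uniformizer powi (- \<gamma> - 1) * of_int (int d - int e)"
        by (simp add: algebra_simps)
      ultimately have "padic_norm (of_int (int d - int e) :: 'p padic) \<le> real CARD('p) powi (- 1)"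
        by (simp only: padic_norm_scaled_le_iff)
      then have "int CARD('p) dvd int d - int e"
        using power_dvd_if_padic_norm_le[of "int d - int e" 1, where ?'p='p] by simp
      then have "int CARD('p) \<le> \<bar>int d - int e\<bar>" using de dvd_imp_le_int[of "int d - int e"] by fastforce
      with de show False by simp
    qed
  qed
  then have "emeasure \<mu> (padic_ball (\<gamma> + 1) 0) = (\<Sum>d<CARD('p). emeasure \<mu> (padic_ball \<gamma> (?c d)))"
    unfolding padic_ball_partition by (intro sum_emeasure[symmetric]) auto
  also have "\<dots> = (\<Sum>d<CARD('p). emeasure \<mu> (padic_ball \<gamma> 0))"
    by (intro sum.cong refl emeasure_padic_ball_center)
  also have "\<dots> = ennreal (real CARD('p)) * emeasure \<mu> (padic_ball \<gamma> 0)"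
    by (simp add: ennreal_of_nat_eq_real_of_nat)
  finally show ?thesis .
qed

lemma emeasure_padic_ball: "emeasure \<mu> (padic_ball \<gamma> a) = ennreal (real CARD('p) powi \<gamma>)"
proof -
  have p: "real CARD('p) > 1" by (rule prime_card_gt_1)
  have "emeasure \<mu> (padic_ball \<gamma> 0) = ennreal (real CARD('p) powi \<gamma>)"
  proof (induction \<gamma> rule: int_induct[where k = 0])
    case base
    show ?case using haar by (simp add: normalized_haar_def padic_ball_def)
  next
    case (step1 i)
    have "real CARD('p) powi (i + 1) = real CARD('p) * real CARD('p) powi i"
      using p by (simp add: power_int_add)
    with step1 p show ?case
      by (simp add: emeasure_padic_ball_Suc ennreal_mult)
  next
    case (step2 i)
    have "real CARD('p) powi i = real CARD('p) * real CARD('p) powi (i - 1)"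
      using p by (simp add: power_int_diff)
    then have "ennreal (real CARD('p)) * emeasure \<mu> (padic_ball (i - 1) 0)
        = ennreal (real CARD('p)) * ennreal (real CARD('p) powi (i - 1))"
      using step2 p emeasure_padic_ball_Suc[of "i - 1"] by (simp add: ennreal_mult)
    then show ?case using p by (simp add: ennreal_mult_cancel_left)
  qed
  then show ?thesis using emeasure_padic_ball_center[of \<gamma> a] by simp
qed

lemma measure_padic_ball: "measure \<mu> (padic_ball \<gamma> a) = real CARD('p) powi \<gamma>"
  using prime_card_gt_1[where ?'p='p] by (simp add: measure_def emeasure_padic_ball)

lemma scale_measurable: "(\<lambda>x. c * x) \<in> measurable \<mu> borel"
  using measurable_affine[of c 0] by (simp add: measurable_cong_sets[OF sets_haar refl])

text \<open>
  The behaviour of Haar measure under dilation, by uniqueness: both measures give the same mass to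
  every ball, and balls form an intersection-stable generator.
\<close>

lemma distr_haar_scale:
  "distr \<mu> borel (\<lambda>x. uniformizer ^ j * x) = density \<mu> (\<lambda>_. ennreal (real CARD('p) ^ j))"
  (is "?L = ?R")
proof (rule measure_eqI_generator_eq[where E = empty_or_ball and \<Omega> = UNIV
      and A = "\<lambda>n. padic_ball (int n) 0"])
  have p: "real CARD('p) > 1" by (rule prime_card_gt_1)
  have ball: "emeasure ?L (padic_ball \<gamma> a) = ennreal (real CARD('p) powi (\<gamma> + int j))" for \<gamma> a
  proof -
    have "(\<lambda>x. uniformizer ^ j * x) -` padic_ball \<gamma> a = padic_ball (\<gamma> + int j) (a / uniformizer ^ j)"
    proof (rule set_eqI)
      fix x
      have "uniformizer ^ j * x - a = uniformizer powi (int j) * (x - a / uniformizer ^ j)"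
        by (simp add: algebra_simps)
      then show "x \<in> (\<lambda>x. uniformizer ^ j * x) -` padic_ball \<gamma> a
          \<longleftrightarrow> x \<in> padic_ball (\<gamma> + int j) (a / uniformizer ^ j)"
        using padic_norm_scaled_le_iff[of "int j" "x - a / uniformizer ^ j" "\<gamma> + int j"]
        by (simp add: padic_ball_def)
    qed
    then show ?thesis
      by (simp add: emeasure_distr[OF scale_measurable] space_haar emeasure_padic_ball open_padic_ball)
  qed
  show "emeasure ?L X = emeasure ?R X" if "X \<in> empty_or_ball" for X
  proof -
    have "emeasure ?R (padic_ball \<gamma> a) = ennreal (real CARD('p) powi (\<gamma> + int j))" for \<gamma> a
      using p by (simp add: emeasure_density_const emeasure_padic_ball power_int_add
          mult.commute flip: ennreal_mult)
    with that ball show ?thesis by (auto simp: empty_or_ball_def)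
  qed
  show "emeasure ?L (padic_ball (int n) 0) \<noteq> \<infinity>" for n unfolding ball by simp
  show "(\<Union>n. padic_ball (int n) 0) = (UNIV :: 'p padic set)"
    using real_arch_pow[OF p] by (force simp: padic_ball_def dest: less_imp_le)
  show "range (\<lambda>n. padic_ball (int n) 0) \<subseteq> (empty_or_ball :: 'p padic set set)"
    by (auto simp: empty_or_ball_def)
qed (simp_all add: Int_stable_empty_or_ball sets_borel_padic sets_haar)

lemma integral_haar_scale:
  fixes f :: "'p padic \<Rightarrow> real"
  assumes "f \<in> borel_measurable \<mu>"
  shows "(\<integral>x. f (uniformizer ^ j * x) \<partial>\<mu>) = real CARD('p) ^ j * (\<integral>x. f x \<partial>\<mu>)"
proof -
  have "f \<in> borel_measurable borel" using assms by (simp add: measurable_cong_sets[OF sets_haar refl])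
  from integral_distr[OF scale_measurable this, of "uniformizer ^ j"] show ?thesis
    using assms by (simp add: distr_haar_scale integral_density)
qed

end


section \<open>Orthogonality in the space of square-integrable functions\<close>

lemma L2_mult_integrable:
  assumes "f \<in> L2 M" "g \<in> L2 M"
  shows "integrable M (\<lambda>x. f x * cnj (g x))"
proof (rule Bochner_Integration.integrable_bound)
  show "integrable M (\<lambda>x. (cmod (f x))\<^sup>2 + (cmod (g x))\<^sup>2)"
    using assms by (simp add: L2_def)
  have [measurable]: "f \<in> borel_measurable M" "g \<in> borel_measurable M"
    using assms by (simp_all add: L2_def)
  have [measurable]: "cnj \<in> borel_measurable borel"
    by (intro borel_measurable_continuous_onI continuous_intros)
  show "(\<lambda>x. f x * cnj (g x)) \<in> borel_measurable M"
    by measurable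
  have "a * b \<le> a\<^sup>2 + b\<^sup>2" if "0 \<le> a" "0 \<le> b" for a b :: real
    using sum_squares_bound[of a b] mult_nonneg_nonneg[OF that] by linarith
  then show "AE x in M. norm (f x * cnj (g x)) \<le> norm ((cmod (f x))\<^sup>2 + (cmod (g x))\<^sup>2)"
    by (simp add: norm_mult)
qed

lemma cmod_add_square: "(cmod (a + b))\<^sup>2 = (cmod a)\<^sup>2 + (cmod b)\<^sup>2 + 2 * Re (a * cnj b)"
  unfolding cmod_power2 by (simp add: power2_eq_square algebra_simps)

lemma L2_add:
  assumes "f \<in> L2 M" "g \<in> L2 M"
  shows "(\<lambda>x. f x + g x) \<in> L2 M"
  using assms integrable_Re[OF L2_mult_integrable[OF assms]]
  by (auto simp: L2_def cmod_add_square simp del: times_complex.sel)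

lemma L2_cmult:
  assumes "f \<in> L2 M"
  shows "(\<lambda>x. c * f x) \<in> L2 M"
  using assms by (auto simp: L2_def norm_mult power_mult_distrib)

lemma L2_diff:
  assumes "f \<in> L2 M" "g \<in> L2 M"
  shows "(\<lambda>x. f x - g x) \<in> L2 M"
  using L2_add[OF assms(1) L2_cmult[OF assms(2), of "-1"]] by simp

lemma L2_sum:
  assumes "\<And>i. i \<in> I \<Longrightarrow> f i \<in> L2 M"
  shows "(\<lambda>x. \<Sum>i\<in>I. f i x) \<in> L2 M"
proof -
  have "(\<lambda>x. 0) \<in> L2 M" by (simp add: L2_def)
  then show ?thesis
    using assms by (induction I rule: infinite_finite_induct) (auto intro: L2_add)
qed

lemma L2_inner_sum_left:
  assumes "\<And>i. i \<in> I \<Longrightarrow> f i \<in> L2 M" "g \<in> L2 M"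
  shows "L2_inner M (\<lambda>x. \<Sum>i\<in>I. c i * f i x) g = (\<Sum>i\<in>I. c i * L2_inner M (f i) g)"
proof -
  have "integrable M (\<lambda>x. c i * (f i x * cnj (g x)))" if "i \<in> I" for i
    using L2_mult_integrable[OF assms(1)[OF that] assms(2)] by simp
  then have "(\<integral>x. (\<Sum>i\<in>I. c i * (f i x * cnj (g x))) \<partial>M) = (\<Sum>i\<in>I. \<integral>x. c i * (f i x * cnj (g x)) \<partial>M)"
    by (rule Bochner_Integration.integral_sum)
  then show ?thesis by (simp add: L2_inner_def sum_distrib_right mult.assoc)
qed

lemma L2_inner_commute: "L2_inner M g f = cnj (L2_inner M f g)"
  unfolding L2_inner_def Bochner_Integration.integral_cnj[symmetric] by (simp add: mult.commute)

lemma L2_inner_self: "L2_inner M f f = of_real (\<integral>x. (cmod (f x))\<^sup>2 \<partial>M)"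
  by (simp add: L2_inner_def flip: complex_norm_square integral_complex_of_real)

lemma L2_pythagoras:
  assumes f: "f \<in> L2 M" and g: "g \<in> L2 M" and "L2_inner M f g = 0"
  shows "(\<integral>x. (cmod (f x + g x))\<^sup>2 \<partial>M) = (\<integral>x. (cmod (f x))\<^sup>2 \<partial>M) + (\<integral>x. (cmod (g x))\<^sup>2 \<partial>M)"
proof -
  have int: "integrable M (\<lambda>x. f x * cnj (g x))" by (rule L2_mult_integrable[OF f g])
  then have "(\<integral>x. Re (f x * cnj (g x)) \<partial>M) = 0"
    using assms(3) by (simp only: integral_Re L2_inner_def) simp
  then show ?thesis
    using f g integrable_Re[OF int] by (simp add: cmod_add_square L2_def del: times_complex.sel)
qed

lemma complex_span_orthogonal:
  assumes "S \<subseteq> L2 M" "u \<in> L2 M" "\<And>g. g \<in> S \<Longrightarrow> L2_inner M u g = 0" "h \<in> complex_span S"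
  shows "h \<in> L2 M \<and> L2_inner M u h = 0"
proof -
  obtain T c where T: "finite T" "T \<subseteq> S" and h: "h = (\<lambda>x. \<Sum>g\<in>T. c g * g x)"
    using assms(4) by (auto simp: complex_span_def)
  have "h \<in> L2 M" unfolding h by (intro L2_sum L2_cmult) (use T assms in auto)
  moreover have "L2_inner M h u = 0"
    unfolding h using T assms
    by (subst L2_inner_sum_left) (auto intro!: sum.neutral simp: L2_inner_commute[of M _ u])
  ultimately show ?thesis using L2_inner_commute[of M u h] by simp
qed

text \<open>
  If \<open>s\<close> lies in the span of \<open>S\<close> and \<open>b - s\<close> is orthogonal to \<open>S\<close>, then \<open>s\<close> is the
  orthogonal projection of \<open>b\<close>, and \<open>b - s\<close> is at most as long as \<open>b - h'\<close> for each \<open>h'\<close> in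
  the span, by Pythagoras. Passing to \<open>h\<close> in the closure through \<open>|x + y|\<^sup>2 \<le> 2|x|\<^sup>2 + 2|y|\<^sup>2\<close>
  costs a factor \<open>2\<close>; the bound is only compared with quantities that tend to \<open>0\<close>.
\<close>

lemma L2_residual_le_distance:
  assumes S: "S \<subseteq> L2 M" and b: "b \<in> L2 M" and s: "s \<in> complex_span S"
    and orth: "\<And>g. g \<in> S \<Longrightarrow> L2_inner M (\<lambda>x. b x - s x) g = 0"
    and h: "h \<in> L2_closure M (complex_span S)"
  shows "(\<integral>x. (cmod (b x - s x))\<^sup>2 \<partial>M) \<le> 2 * (\<integral>x. (cmod (b x - h x))\<^sup>2 \<partial>M)"
proof (rule field_le_epsilon)
  fix e :: real assume e: "0 < e"
  have s_L2: "s \<in> L2 M"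
    using s S by (auto simp: complex_span_def intro!: L2_sum L2_cmult)
  then have u: "(\<lambda>x. b x - s x) \<in> L2 M" by (rule L2_diff[OF b])
  have "sqrt (e / 2) > 0" using e by simp
  then obtain h' where h': "h' \<in> complex_span S" "L2_norm M (\<lambda>x. h x - h' x) < sqrt (e / 2)"
    using h unfolding L2_closure_def by blast
  from h'(2) have close: "(\<integral>x. (cmod (h x - h' x))\<^sup>2 \<partial>M) < e / 2"
    by (simp add: L2_norm_def)
  have orth': "k \<in> L2 M \<and> L2_inner M (\<lambda>x. b x - s x) k = 0" if "k \<in> complex_span S" for k
    using complex_span_orthogonal[OF S u _ that] orth by blast
  have hL: "h \<in> L2 M" using h by (simp add: L2_closure_def)
  have h'L: "h' \<in> L2 M" using orth'[OF h'(1)] by simp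
  have w: "(\<lambda>x. s x - h' x) \<in> L2 M" by (rule L2_diff[OF s_L2 h'L])
  have "L2_inner M (\<lambda>x. b x - s x) (\<lambda>x. s x - h' x)
      = L2_inner M (\<lambda>x. b x - s x) s - L2_inner M (\<lambda>x. b x - s x) h'"
    using L2_mult_integrable[OF u s_L2] L2_mult_integrable[OF u h'L]
    by (simp add: L2_inner_def right_diff_distrib Bochner_Integration.integral_diff)
  then have "L2_inner M (\<lambda>x. b x - s x) (\<lambda>x. s x - h' x) = 0"
    using orth'[OF s] orth'[OF h'(1)] by simp
  from L2_pythagoras[OF u w this]
  have "(\<integral>x. (cmod (b x - s x))\<^sup>2 \<partial>M) \<le> (\<integral>x. (cmod (b x - h' x))\<^sup>2 \<partial>M)"
    by simp
  also have "\<dots> \<le> (\<integral>x. 2 * (cmod (b x - h x))\<^sup>2 + 2 * (cmod (h x - h' x))\<^sup>2 \<partial>M)"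
  proof (rule integral_mono)
    show "integrable M (\<lambda>x. (cmod (b x - h' x))\<^sup>2)" using L2_diff[OF b h'L] by (simp add: L2_def)
    show "integrable M (\<lambda>x. 2 * (cmod (b x - h x))\<^sup>2 + 2 * (cmod (h x - h' x))\<^sup>2)"
      using L2_diff[OF b hL] L2_diff[OF hL h'L] by (simp add: L2_def)
    fix x
    have "cmod (b x - h' x) \<le> cmod (b x - h x) + cmod (h x - h' x)"
      using norm_triangle_ineq[of "b x - h x" "h x - h' x"] by simp
    then have "(cmod (b x - h' x))\<^sup>2 \<le> (cmod (b x - h x) + cmod (h x - h' x))\<^sup>2"
      by (rule power_mono) simp
    also have "\<dots> \<le> 2 * (cmod (b x - h x))\<^sup>2 + 2 * (cmod (h x - h' x))\<^sup>2"
      using sum_squares_bound[of "cmod (b x - h x)" "cmod (h x - h' x)"]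
      by (simp add: power2_sum)
    finally show "(cmod (b x - h' x))\<^sup>2 \<le> 2 * (cmod (b x - h x))\<^sup>2 + 2 * (cmod (h x - h' x))\<^sup>2" .
  qed
  also have "\<dots> = 2 * (\<integral>x. (cmod (b x - h x))\<^sup>2 \<partial>M) + 2 * (\<integral>x. (cmod (h x - h' x))\<^sup>2 \<partial>M)"
    using L2_diff[OF b hL] L2_diff[OF hL h'L] by (simp add: L2_def)
  finally show "(\<integral>x. (cmod (b x - s x))\<^sup>2 \<partial>M) \<le> 2 * (\<integral>x. (cmod (b x - h x))\<^sup>2 \<partial>M) + e"
    using close by simp
qed

section \<open>Sums of translates in a multiresolution analysis\<close>

lemma MRA_increasing:
  assumes "MRA \<mu> V" "i \<le> j"
  shows "V i \<subseteq> V j"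
proof -
  have step: "V i \<subseteq> V (i + 1)" for i using assms(1) by (simp add: MRA_def)
  have "V i \<subseteq> V (i + int k)" for k
  proof (induction k)
    case (Suc k)
    then show ?case using step[of "i + int k"] by (auto simp: algebra_simps)
  qed simp
  from this[of "nat (j - i)"] show ?thesis using assms(2) by simp
qed

lemma MRA_dilate_to_V0:
  fixes V :: "int \<Rightarrow> ('p::prime_card padic \<Rightarrow> complex) set"
  assumes "MRA \<mu> V" "g \<in> V (int j)"
  shows "(\<lambda>x. g (uniformizer ^ j * x)) \<in> V 0"
  using assms(2)
proof (induction j arbitrary: g)
  case (Suc j)
  have "(\<lambda>x. g (uniformizer * (inverse uniformizer * x))) \<in> V (int j + 1)"
    using Suc.prems by (simp add: algebra_simps flip: mult.assoc)
  moreover have "f \<in> V i \<longleftrightarrow> (\<lambda>x. f (inverse uniformizer * x)) \<in> V (i + 1)" for f i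
    using assms(1) by (simp add: MRA_def)
  ultimately have "(\<lambda>x. g (uniformizer * x)) \<in> V (int j)" by blast
  from Suc.IH[OF this] show ?case by (simp add: mult.assoc)
qed simp

lemma orthonormal_translates:
  assumes "orthogonal_scaling_function \<mu> \<phi>"
  obtains V where "MRA \<mu> V"
    "V 0 = L2_closure \<mu> (complex_span (translate \<phi> ` shift_set))"
    "\<And>a. a \<in> shift_set \<Longrightarrow> translate \<phi> a \<in> L2 \<mu>"
    "\<And>a b. a \<in> shift_set \<Longrightarrow> b \<in> shift_set \<Longrightarrow>
       L2_inner \<mu> (translate \<phi> a) (translate \<phi> b) = (if a = b then 1 else 0)"
proof -
  obtain V where V: "MRA \<mu> V" "scaling_function_of \<mu> V \<phi>"
    "L2_orthonormal_basis \<mu> (V 0) shift_set (translate \<phi>)"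
    using assms by (auto simp: orthogonal_scaling_function_def)
  have "V 0 \<subseteq> L2 \<mu>" using V(1) by (simp add: MRA_def L2_closed_subspace_def)
  with V show ?thesis
    by (intro that[of V]) (auto simp: scaling_function_of_def L2_orthonormal_basis_def)
qed

abbreviation level_shifts :: "nat \<Rightarrow> 'p::prime_card padic set" where
  "level_shifts n \<equiv> shift_set \<inter> padic_ball (int n) 0"

lemma finite_level_shifts: "finite (level_shifts n)"
  by (simp add: shift_set_Int_ball)

lemma card_level_shifts: "card (level_shifts n :: 'p::prime_card padic set) = CARD('p) ^ n"
  unfolding shift_set_Int_ball by (subst card_image[OF inj_on_fractions]) simp

definition shift_sum :: "('p::prime_card padic \<Rightarrow> complex) \<Rightarrow> nat \<Rightarrow> 'p padic \<Rightarrow> complex" where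
  "shift_sum \<phi> n x = (\<Sum>a\<in>level_shifts n. translate \<phi> a x)"

lemma shift_sum_eq:
  "shift_sum \<phi> n x = (\<Sum>k<CARD('p) ^ n. \<phi> (x - of_nat k / uniformizer ^ n :: 'p::prime_card padic))"
  unfolding shift_sum_def shift_set_Int_ball
  by (subst sum.reindex[OF inj_on_fractions]) (simp add: translate_def)

text \<open>
  Because the shifts of level \<open>n\<close> are consecutive multiples of \<open>p\<^sup>-\<^sup>n\<close>, translating by
  \<open>p\<^sup>-\<^sup>n\<close> moves each summand to the next one and the difference telescopes. The last multiple
  passed is \<open>p\<^sup>n p\<^sup>-\<^sup>n = 1\<close>, which is where the unit period comes from.
\<close>

lemma shift_sum_shift_diff:
  "shift_sum \<phi> n (x - 1 / uniformizer ^ n) - shift_sum \<phi> n x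
     = \<phi> (x - 1) - \<phi> (x :: 'p::prime_card padic)"
proof -
  define g where "g k = \<phi> (x - of_nat k / uniformizer ^ n)" for k :: nat
  have "x - 1 / uniformizer ^ n - of_nat k / uniformizer ^ n
      = x - of_nat (Suc k) / uniformizer ^ n" for k
    by (simp add: diff_diff_eq add_divide_distrib)
  then have "shift_sum \<phi> n (x - 1 / uniformizer ^ n) - shift_sum \<phi> n x
      = (\<Sum>k<CARD('p) ^ n. g (Suc k) - g k)"
    unfolding shift_sum_eq g_def by (simp only: sum_subtractf)
  also have "\<dots> = g (CARD('p) ^ n) - g 0" by (rule sum_lessThan_telescope)
  finally show ?thesis by (simp add: g_def)
qed

context
  fixes \<mu> :: "'p::prime_card padic measure" and \<phi> :: "'p padic \<Rightarrow> complex" and N :: int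
  assumes haar: "normalized_haar \<mu>"
    and supp: "\<And>x. \<phi> x \<noteq> 0 \<Longrightarrow> x \<in> padic_ball N 0"
    and L2_translate: "\<And>a. a \<in> shift_set \<Longrightarrow> translate \<phi> a \<in> L2 \<mu>"
    and orthonormal: "\<And>a b. a \<in> shift_set \<Longrightarrow> b \<in> shift_set \<Longrightarrow>
       L2_inner \<mu> (translate \<phi> a) (translate \<phi> b) = (if a = b then 1 else 0)"
begin

private abbreviation ball_fun :: "nat \<Rightarrow> 'p padic \<Rightarrow> complex" where
  "ball_fun n \<equiv> indicator (padic_ball (int n) 0)"

lemma phi_L2: "\<phi> \<in> L2 \<mu>"
  using L2_translate[OF zero_in_shift_set] by (simp add: translate_def)

lemma phi_measurable: "\<phi> \<in> borel_measurable \<mu>"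
  using phi_L2 by (simp add: L2_def)

lemma cmod_ball_fun: "(cmod (ball_fun n x))\<^sup>2 = indicator (padic_ball (int n) 0) x"
  by (simp add: indicator_def)

lemma ball_fun_L2: "ball_fun n \<in> L2 \<mu>"
proof -
  have [measurable]: "padic_ball (int n) 0 \<in> sets \<mu>" by (rule padic_ball_measurable[OF haar])
  have "integrable \<mu> (\<lambda>x. (cmod (ball_fun n x))\<^sup>2)"
    unfolding cmod_ball_fun
    by (intro integrable_real_indicator) (simp_all add: emeasure_padic_ball[OF haar])
  then show ?thesis by (simp add: L2_def)
qed

lemma integral_ball_fun: "(\<integral>x. (cmod (ball_fun n x))\<^sup>2 \<partial>\<mu>) = real CARD('p) ^ n"
  unfolding cmod_ball_fun
  by (simp add: measure_padic_ball[OF haar] space_haar[OF haar])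

lemma translate_inj: "inj_on (translate \<phi>) shift_set"
proof (rule inj_onI)
  fix a b :: "'p padic" assume ab: "a \<in> shift_set" "b \<in> shift_set" "translate \<phi> a = translate \<phi> b"
  then show "a = b" using orthonormal[OF ab(1,2)] orthonormal[OF ab(1,1)] by (auto split: if_splits)
qed

lemma scaled_shift_sum_in_span:
  "(\<lambda>x. c * shift_sum \<phi> n x) \<in> complex_span (translate \<phi> ` shift_set)"
proof -
  let ?T = "translate \<phi> ` level_shifts n"
  have inj: "inj_on (translate \<phi>) (level_shifts n)"
    using translate_inj by (rule inj_on_subset) blast
  have "(\<lambda>x. c * shift_sum \<phi> n x) = (\<lambda>x. \<Sum>g\<in>?T. c * g x)"
    by (simp add: shift_sum_def sum_distrib_left sum.reindex[OF inj])
  moreover have "finite ?T" "?T \<subseteq> translate \<phi> ` shift_set"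
    using finite_level_shifts by auto
  ultimately show ?thesis
    unfolding complex_span_def by (intro CollectI exI[of _ ?T] exI[of _ "\<lambda>_. c"] conjI)
qed

lemma shift_sum_L2: "shift_sum \<phi> n \<in> L2 \<mu>"
  unfolding shift_sum_def by (intro L2_sum) (simp add: L2_translate)

lemma inner_shift_sum:
  assumes "a \<in> shift_set"
  shows "L2_inner \<mu> (shift_sum \<phi> n) (translate \<phi> a)
    = (if a \<in> padic_ball (int n) 0 then 1 else 0)"
proof -
  have "L2_inner \<mu> (shift_sum \<phi> n) (translate \<phi> a)
      = (\<Sum>b\<in>level_shifts n. 1 * L2_inner \<mu> (translate \<phi> b) (translate \<phi> a))"
    using L2_inner_sum_left[of "level_shifts n" "translate \<phi>" \<mu> "translate \<phi> a" "\<lambda>_. 1"]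
      L2_translate assms by (simp add: shift_sum_def[abs_def])
  also have "\<dots> = (\<Sum>b\<in>level_shifts n. if b = a then 1 else 0)"
    using assms by (intro sum.cong) (auto simp: orthonormal)
  also have "\<dots> = (if a \<in> padic_ball (int n) 0 then 1 else 0)"
    using assms by (simp add: finite_level_shifts)
  finally show ?thesis .
qed

lemma integral_shift_sum: "(\<integral>x. (cmod (shift_sum \<phi> n x))\<^sup>2 \<partial>\<mu>) = real CARD('p) ^ n"
proof -
  have "L2_inner \<mu> (shift_sum \<phi> n) (shift_sum \<phi> n)
      = (\<Sum>a\<in>level_shifts n. 1 * L2_inner \<mu> (translate \<phi> a) (shift_sum \<phi> n))"
    using L2_inner_sum_left[of "level_shifts n" "translate \<phi>" \<mu> "shift_sum \<phi> n" "\<lambda>_. 1"]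
      L2_translate shift_sum_L2 by (simp add: shift_sum_def[abs_def])
  also have "\<dots> = (\<Sum>a\<in>(level_shifts n :: 'p padic set). 1)"
    by (intro sum.cong) (auto simp: inner_shift_sum L2_inner_commute[of \<mu> _ "shift_sum \<phi> n"])
  also have "\<dots> = of_real (real CARD('p) ^ n)"
    by (simp add: card_level_shifts)
  finally show ?thesis unfolding L2_inner_self of_real_eq_iff .
qed

text \<open>
  For a shift inside the ball the translate is supported in the ball, and the inner product is the
  full integral; for a shift outside, the two supports are disjoint.
\<close>

lemma inner_ball_fun:
  assumes n: "N \<le> int n" and a: "a \<in> shift_set"
  shows "L2_inner \<mu> (ball_fun n) (translate \<phi> a)
    = (if a \<in> padic_ball (int n) 0 then cnj (\<integral>x. \<phi> x \<partial>\<mu>) else 0)"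
proof -
  have supp': "x - a \<in> padic_ball (int n) 0" if "\<phi> (x - a) \<noteq> 0" for x
    using supp[OF that] padic_ball_mono[OF n] by blast
  show ?thesis
  proof (cases "a \<in> padic_ball (int n) 0")
    case True
    have "ball_fun n x * cnj (translate \<phi> a x) = cnj (\<phi> (x + - a))" for x
      using supp'[of x] padic_ball_diff_iff[OF True, of x 0]
      by (auto simp: indicator_def translate_def)
    then have "L2_inner \<mu> (ball_fun n) (translate \<phi> a) = (\<integral>x. cnj (\<phi> (x + - a)) \<partial>\<mu>)"
      by (simp only: L2_inner_def)
    also have "\<dots> = cnj (\<integral>x. \<phi> (x + - a) \<partial>\<mu>)" by (rule Bochner_Integration.integral_cnj)
    also have "\<dots> = cnj (\<integral>x. \<phi> x \<partial>\<mu>)"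
      by (simp only: integral_haar_translate[OF haar phi_measurable])
    finally show ?thesis using True by simp
  next
    case False
    have "ball_fun n x * cnj (translate \<phi> a x) = 0" for x
    proof (rule ccontr)
      assume "ball_fun n x * cnj (translate \<phi> a x) \<noteq> 0"
      then have x: "x \<in> padic_ball (int n) 0" "x - a \<in> padic_ball (int n) 0"
        using supp'[of x] by (auto simp: indicator_def translate_def split: if_splits)
      then have "x - (x - a) \<in> padic_ball (int n) 0" by (subst padic_ball_diff_iff)
      with False show False by simp
    qed
    then have "L2_inner \<mu> (ball_fun n) (translate \<phi> a) = (\<integral>x. 0 \<partial>\<mu>)"
      by (simp only: L2_inner_def)
    with False show ?thesis by simp
  qed
qed

text \<open>
  Hence the indicator of a large ball has the shift sum times the conjugate of \<open>\<integral>\<phi>\<close> as its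
  orthogonal projection to \<open>V\<^sub>0\<close>.
\<close>

lemma residual_orthogonal:
  assumes "N \<le> int n" "g \<in> translate \<phi> ` shift_set"
  shows "L2_inner \<mu> (\<lambda>x. ball_fun n x - cnj (\<integral>x. \<phi> x \<partial>\<mu>) * shift_sum \<phi> n x) g = 0"
proof -
  let ?c = "cnj (\<integral>x. \<phi> x \<partial>\<mu>)"
  obtain a where a: "a \<in> shift_set" "g = translate \<phi> a" using assms(2) by blast
  have g: "g \<in> L2 \<mu>" using a L2_translate by simp
  have "L2_inner \<mu> (\<lambda>x. ball_fun n x - ?c * shift_sum \<phi> n x) g
      = L2_inner \<mu> (ball_fun n) g - ?c * L2_inner \<mu> (shift_sum \<phi> n) g"
    using L2_mult_integrable[OF ball_fun_L2 g] L2_mult_integrable[OF shift_sum_L2 g]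
    by (simp add: L2_inner_def left_diff_distrib mult.assoc Bochner_Integration.integral_diff)
  then show ?thesis
    using inner_ball_fun[OF assms(1) a(1)] inner_shift_sum[OF a(1)] by (simp add: a(2))
qed

lemma residual_norm:
  assumes "N \<le> int n"
  shows "(\<integral>x. (cmod (ball_fun n x - cnj (\<integral>x. \<phi> x \<partial>\<mu>) * shift_sum \<phi> n x))\<^sup>2 \<partial>\<mu>)
    = real CARD('p) ^ n * (1 - (cmod (\<integral>x. \<phi> x \<partial>\<mu>))\<^sup>2)"
proof -
  let ?c = "cnj (\<integral>x. \<phi> x \<partial>\<mu>)"
  let ?s = "\<lambda>x. ?c * shift_sum \<phi> n x" and ?u = "\<lambda>x. ball_fun n x - ?c * shift_sum \<phi> n x"
  have s: "?s \<in> L2 \<mu>" by (intro L2_cmult shift_sum_L2)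
  have u: "?u \<in> L2 \<mu>" by (intro L2_diff ball_fun_L2 s)
  have "L2_inner \<mu> ?u ?s = 0"
    using complex_span_orthogonal[OF _ u residual_orthogonal[OF assms] scaled_shift_sum_in_span]
      L2_translate by blast
  from L2_pythagoras[OF u s this]
  have "(\<integral>x. (cmod (ball_fun n x))\<^sup>2 \<partial>\<mu>)
      = (\<integral>x. (cmod (?u x))\<^sup>2 \<partial>\<mu>) + (\<integral>x. (cmod (?s x))\<^sup>2 \<partial>\<mu>)" by simp
  moreover have "(\<integral>x. (cmod (?s x))\<^sup>2 \<partial>\<mu>) = (cmod ?c)\<^sup>2 * real CARD('p) ^ n"
    by (simp add: norm_mult power_mult_distrib integral_shift_sum)
  ultimately show ?thesis by (simp add: integral_ball_fun algebra_simps)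
qed

lemma distance_to_V0:
  assumes "N \<le> int n" "h \<in> L2_closure \<mu> (complex_span (translate \<phi> ` shift_set))"
  shows "real CARD('p) ^ n * (1 - (cmod (\<integral>x. \<phi> x \<partial>\<mu>))\<^sup>2)
    \<le> 2 * (\<integral>x. (cmod (ball_fun n x - h x))\<^sup>2 \<partial>\<mu>)"
  unfolding residual_norm[OF assms(1), symmetric]
proof (rule L2_residual_le_distance[OF _ ball_fun_L2 scaled_shift_sum_in_span _ assms(2)])
  show "translate \<phi> ` shift_set \<subseteq> L2 \<mu>" using L2_translate by blast
qed (rule residual_orthogonal[OF assms(1)])

text \<open>
  Dilation by \<open>p\<^sup>j\<close> carries \<open>V\<^sub>j\<close> to \<open>V\<^sub>0\<close> and the ball of level \<open>n\<close> to the ball of level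
  \<open>n + j\<close>, and it multiplies squared norms by \<open>p\<^sup>j\<close>. This is the same factor by which the
  lower bound for the squared distance to \<open>V\<^sub>0\<close> grows, so the indicator of one fixed ball keeps a
  squared distance of at least \<open>p\<^sup>n (1 - |\<integral>\<phi>|\<^sup>2) / 2\<close> to every \<open>V\<^sub>j\<close>. Density of their union
  makes this at most \<open>0\<close>.
\<close>

lemma cmod_integral_ge_1:
  assumes V: "MRA \<mu> V" and V0: "V 0 = L2_closure \<mu> (complex_span (translate \<phi> ` shift_set))"
  shows "1 \<le> (cmod (\<integral>x. \<phi> x \<partial>\<mu>))\<^sup>2"
proof (rule field_le_epsilon)
  fix e :: real assume e: "0 < e"
  \<comment> \<open>A natural level whose ball contains the ball of level \<open>N\<close>, hence the support of \<open>\<phi>\<close>.\<close>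
  define n where "n = nat N"
  let ?p = "real CARD('p)"
  have p: "?p > 1" by (rule prime_card_gt_1)
  have "ball_fun n \<in> L2_closure \<mu> (\<Union>j. V j)" using V ball_fun_L2 by (simp add: MRA_def)
  moreover have "sqrt (e / 2) > 0" using e by simp
  ultimately obtain i g where g: "g \<in> V i" "L2_norm \<mu> (\<lambda>x. ball_fun n x - g x) < sqrt (e / 2)"
    unfolding L2_closure_def by blast
  \<comment> \<open>Only nonnegative \<open>j\<close> are dilated back to \<open>V\<^sub>0\<close>; a negative index is raised to \<open>0\<close>.\<close>
  define j where "j = nat i"
  have gj: "g \<in> V (int j)" using g(1) MRA_increasing[OF V, of i "int j"] by (auto simp: j_def)
  then have gL: "g \<in> L2 \<mu>" using V by (auto simp: MRA_def L2_closed_subspace_def)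
  define h where "h x = g (uniformizer ^ j * x)" for x
  have "h \<in> V 0" unfolding h_def using MRA_dilate_to_V0[OF V gj] .
  then have "?p ^ (n + j) * (1 - (cmod (\<integral>x. \<phi> x \<partial>\<mu>))\<^sup>2)
      \<le> 2 * (\<integral>x. (cmod (ball_fun (n + j) x - h x))\<^sup>2 \<partial>\<mu>)"
    by (intro distance_to_V0) (auto simp: V0 n_def)
  also have "ball_fun (n + j) x = ball_fun n (uniformizer ^ j * x)" for x
    using padic_norm_scaled_le_iff[of "int j" x "int (n + j)"]
    by (simp add: indicator_def padic_ball_def)
  then have "(\<integral>x. (cmod (ball_fun (n + j) x - h x))\<^sup>2 \<partial>\<mu>)
      = (\<integral>x. (\<lambda>y. (cmod (ball_fun n y - g y))\<^sup>2) (uniformizer ^ j * x) \<partial>\<mu>)"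
    by (simp only: h_def)
  also have "\<dots> = ?p ^ j * (\<integral>x. (cmod (ball_fun n x - g x))\<^sup>2 \<partial>\<mu>)"
    using L2_diff[OF ball_fun_L2 gL, of n]
    by (intro integral_haar_scale[OF haar] borel_measurable_integrable) (simp add: L2_def)
  finally have "?p ^ j * (?p ^ n * (1 - (cmod (\<integral>x. \<phi> x \<partial>\<mu>))\<^sup>2))
      \<le> ?p ^ j * (2 * (\<integral>x. (cmod (ball_fun n x - g x))\<^sup>2 \<partial>\<mu>))"
    by (simp add: power_add mult_ac)
  then have "?p ^ n * (1 - (cmod (\<integral>x. \<phi> x \<partial>\<mu>))\<^sup>2) \<le> 2 * (\<integral>x. (cmod (ball_fun n x - g x))\<^sup>2 \<partial>\<mu>)"
    using p by (simp only: mult_le_cancel_left_pos zero_less_power)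
  also have "\<dots> \<le> e" using g(2) by (simp add: L2_norm_def)
  also have "\<dots> \<le> ?p ^ n * e" using e p by simp
  finally have "1 - (cmod (\<integral>x. \<phi> x \<partial>\<mu>))\<^sup>2 \<le> e"
    using p by (simp only: mult_le_cancel_left_pos zero_less_power)
  then show "1 \<le> (cmod (\<integral>x. \<phi> x \<partial>\<mu>))\<^sup>2 + e" by simp
qed

text \<open>
  Now the residual has norm \<open>0\<close>, so the shift sum is almost everywhere a nonzero multiple of the
  indicator of the ball. That indicator is invariant under \<open>p\<^sup>-\<^sup>n\<close>, a point of the ball.
\<close>

lemma AE_unit_periodic:
  assumes "1 \<le> (cmod (\<integral>x. \<phi> x \<partial>\<mu>))\<^sup>2"
  shows "AE x in \<mu>. \<phi> (x - 1) = \<phi> x"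
proof -
  define n where "n = nat N"
  let ?c = "cnj (\<integral>x. \<phi> x \<partial>\<mu>)"
  let ?u = "\<lambda>x. ball_fun n x - ?c * shift_sum \<phi> n x"
  let ?t = "1 / uniformizer ^ n :: 'p padic"
  have c: "?c \<noteq> 0" using assms by auto
  have "?u \<in> L2 \<mu>" by (intro L2_diff L2_cmult ball_fun_L2 shift_sum_L2)
  then have int: "integrable \<mu> (\<lambda>x. (cmod (?u x))\<^sup>2)" by (simp add: L2_def)
  have "(\<integral>x. (cmod (?u x))\<^sup>2 \<partial>\<mu>) \<le> 0"
    using assms by (subst residual_norm) (auto simp: n_def mult_nonneg_nonpos)
  moreover have "(\<integral>x. (cmod (?u x))\<^sup>2 \<partial>\<mu>) \<ge> 0" by (rule integral_nonneg_AE) simp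
  ultimately have "(\<integral>x. (cmod (?u x))\<^sup>2 \<partial>\<mu>) = 0" by linarith
  then have "AE x in \<mu>. (cmod (?u x))\<^sup>2 = 0"
    by (subst (asm) integral_nonneg_eq_0_iff_AE[OF int]) auto
  then have const: "AE x in \<mu>. ball_fun n x = ?c * shift_sum \<phi> n x" by simp
  have t: "?t \<in> padic_ball (int n) 0"
    by (simp add: padic_ball_def padic_norm_uniformizer_power power_int_minus
        divide_inverse padic_norm_inverse)
  from AE_haar_translate[OF haar const, of "- ?t"] const show ?thesis
  proof eventually_elim
    case (elim x)
    have "ball_fun n (x - ?t) = ball_fun n x"
      using padic_ball_diff_iff[OF t, of x 0] by (simp add: indicator_def)
    with elim have "?c * shift_sum \<phi> n (x - ?t) = ?c * shift_sum \<phi> n x"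
      by (simp only: diff_conv_add_uminus)
    then have "shift_sum \<phi> n (x - ?t) = shift_sum \<phi> n x" using c by simp
    with shift_sum_shift_diff[of \<phi> n x] show ?case by simp
  qed
qed

end

section \<open>The Fourier transform of a function of period one\<close>

lemma measurable_padic_char: "padic_char \<in> borel_measurable (borel :: 'p::prime_card padic measure)"
proof (rule borel_measurable_continuous_onI)
  show "continuous_on UNIV (padic_char :: 'p padic \<Rightarrow> complex)"
    unfolding continuous_on_iff
  proof (intro ballI allI impI exI conjI)
    fix x y :: "'p padic" and e :: real assume e: "0 < e" and "dist y x < 1"
    then have "padic_char (y - x) = 1" by (simp add: padic_char_eq_1_iff dist_padic_def)
    then have "padic_char y = padic_char x" using padic_char_add[of x "y - x"] by simp
    with e show "dist (padic_char y) (padic_char x) < e" by simp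
  qed simp
qed

text \<open>
  Substituting \<open>x - 1\<close> for \<open>x\<close> multiplies the integral by \<open>\<chi>(-\<xi>)\<close>, which differs from \<open>1\<close>
  exactly when \<open>|\<xi>| > 1\<close>.
\<close>

lemma fourier_vanishes_outside_unit_ball:
  fixes \<xi> :: "'p::prime_card padic"
  assumes haar: "normalized_haar \<mu>" and meas: "\<phi> \<in> borel_measurable \<mu>"
    and periodic: "AE x in \<mu>. \<phi> (x - 1) = \<phi> x" and \<xi>: "padic_norm \<xi> > 1"
  shows "fourier \<mu> \<phi> \<xi> = 0"
proof -
  note [measurable] = meas
  have [measurable]: "(\<lambda>x. padic_char (\<xi> * x)) \<in> borel_measurable \<mu>"
    by (rule measurable_compose[OF scale_measurable[OF haar] measurable_padic_char])
  let ?f = "\<lambda>x. padic_char (\<xi> * x) * \<phi> x"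
  have f: "?f \<in> borel_measurable \<mu>" by measurable
  have "fourier \<mu> \<phi> \<xi> = (\<integral>x. ?f (x + - 1) \<partial>\<mu>)"
    unfolding fourier_def by (rule integral_haar_translate[OF haar f, symmetric])
  also have "\<dots> = (\<integral>x. padic_char (- \<xi>) * ?f x \<partial>\<mu>)"
  proof (rule integral_cong_AE)
    have "?f \<in> borel_measurable borel" using f by (simp add: measurable_cong_sets[OF sets_haar[OF haar] refl])
    then show "(\<lambda>x. ?f (x + - 1)) \<in> borel_measurable \<mu>"
      by (rule measurable_compose[OF translate_measurable[OF haar]])
    show "(\<lambda>x. padic_char (- \<xi>) * ?f x) \<in> borel_measurable \<mu>" using f by simp
    show "AE x in \<mu>. ?f (x + - 1) = padic_char (- \<xi>) * ?f x"
      using periodic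
    proof eventually_elim
      case (elim x)
      have "padic_char (\<xi> * (x + - 1)) = padic_char (- \<xi>) * padic_char (\<xi> * x)"
        by (simp flip: padic_char_add add: algebra_simps)
      with elim show ?case by simp
    qed
  qed
  also have "\<dots> = padic_char (- \<xi>) * fourier \<mu> \<phi> \<xi>" by (simp add: fourier_def)
  finally have "(1 - padic_char (- \<xi>)) * fourier \<mu> \<phi> \<xi> = 0" by (simp add: algebra_simps)
  moreover have "padic_char (- \<xi>) \<noteq> 1"
    using \<xi> by (simp add: padic_char_eq_1_iff padic_norm_minus)
  ultimately show ?thesis by simp
qed

section \<open>The support of the Fourier transform of the scaling function\<close>

theorem theorem4p3:
  fixes \<mu> :: "'p::prime_card padic measure"
    and \<phi> :: "'p padic \<Rightarrow> complex"
    and M N :: int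
  assumes "normalized_haar \<mu>"
    and "\<phi> \<in> test_functions_NM N M"
    and "orthogonal_scaling_function \<mu> \<phi>"
    and "fourier \<mu> \<phi> 0 \<noteq> 0"
  shows "closed_support (fourier \<mu> \<phi>) \<subseteq> padic_ball 0 0"
proof -
  obtain V where V: "MRA \<mu> V"
    and V0: "V 0 = L2_closure \<mu> (complex_span (translate \<phi> ` shift_set))"
    and L2: "\<And>a. a \<in> shift_set \<Longrightarrow> translate \<phi> a \<in> L2 \<mu>"
    and orthonormal: "\<And>a b. a \<in> shift_set \<Longrightarrow> b \<in> shift_set \<Longrightarrow>
       L2_inner \<mu> (translate \<phi> a) (translate \<phi> b) = (if a = b then 1 else 0)"
    using orthonormal_translates[OF assms(3)] by blast
  have supp: "x \<in> padic_ball N 0" if "\<phi> x \<noteq> 0" for x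
    using assms(2) that closure_subset[of "{x. \<phi> x \<noteq> 0}"]
    by (auto simp: test_functions_NM_def closed_support_def)
  have periodic: "AE x in \<mu>. \<phi> (x - 1) = \<phi> x"
    by (intro AE_unit_periodic[OF assms(1) supp L2 orthonormal]
        cmod_integral_ge_1[OF assms(1) supp L2 orthonormal V V0])
  have "\<phi> \<in> borel_measurable \<mu>"
    by (intro phi_measurable[OF assms(1) supp L2 orthonormal])
  then have "{\<xi>. fourier \<mu> \<phi> \<xi> \<noteq> 0} \<subseteq> padic_ball 0 0"
    using fourier_vanishes_outside_unit_ball[OF assms(1) _ periodic]
    by (force simp: padic_ball_def not_le[symmetric])
  then show ?thesis
    unfolding closed_support_def by (rule closure_minimal) (rule closed_padic_ball)
qed

end
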